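(* Let $\mathbb{F}$ be a field and let $L$ be a nilpotent symplectic alternating algebra over $\mathbb{F}$ of dimension $10$ with an isotropic center of dimension $2$ that is of class $7$ and has the further properties that $L^{4}L^{3}=L^{7}$ and $\dim UL^{2}=2$, where $U=U(L)$ is the characteristic ideal defined in the context. Then $L$ can be given by a presentation of the form $$\mathcal{P}_{10}^{(2,4)}(r):\ (x_{3}y_{4},y_{5})=r,\ (x_{2}y_{3},y_{5})=1,\ (x_{1}y_{2},y_{5})=1,\ (x_{1}y_{3},y_{4})=1,\ (y_{1}y_{2},y_{4})=1,$$ where $r\in\mathbb{F}$, $r\neq 0$. Furthermore, for $r,s\in\mathbb{F}^{*}$, two such presentations $\mathcal{P}_{10}^{(2,4)}(r)$ and $\mathcal{P}_{10}^{(2,4)}(s)$ describe the same algebra (up to isomorphism) if and only if $s/r\in(\mathbb{F}^{*})^{11}$. Conversely, any algebra with such a presentation has the properties stated.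
   Context: A symplectic alternating algebra (SAA) over a field $\mathbb{F}$ is a finite-dimensional $\mathbb{F}$-vector space $L$ with a non-degenerate alternating bilinear form $(\cdot,\cdot)$ and a bilinear alternating product $L\times L\to L$, $(x,y)\mapsto xy$ (so $xx=0$), such that $(xy,z)=(yz,x)$ for all $x,y,z\in L$. Consequently $(u,v,w)\mapsto (uv,w)$ is an alternating trilinear form, and by non-degeneracy it determines the product. An isomorphism of SAAs is a linear bijection preserving both the product and the form. For subspaces $A,B\le L$, $AB$ denotes the linear span of all products $ab$ with $a\in A$, $b\in B$. Put $L^{1}=L$, $L^{k+1}=L^{k}L$; $L$ is nilpotent if $L^{k+1}=0$ for some $k$, and the smallest such $k$ is its (nilpotence) class. The center is $Z(L)=\{z\in L: zx=0 \text{ for all } x\in L\}$. A subspace $A$ is isotropic if $(u,v)=0$ for all $u,v\in A$. $\mathbb{F}^{*}=\mathbb{F}\setminus\{0\}$ and $(\mathbb{F}^{*})^{m}=\{a^{m}:a\in\mathbb{F}^{*}\}$. A standard basis of a $10$-dimensional $L$ is a basis $x_{1},y_{1},\ldots,x_{5},y_{5}$ with $(x_i,x_j)=(y_i,y_j)=0$ and $(x_i,y_j)=\delta_{ij}$. A nilpotent presentation lists values of the triples $(x_iy_j,y_k)$ and $(y_iy_j,y_k)$ with $1\le i<j<k\le 5$ with respect to a standard basis. By convention, all triple values $(uv,w)$ of basis vectors $u,v,w$ which do not follow from the listed ones by the alternating property are $0$. Such a presentation determines an SAA up to isomorphism. Definition of $U$: let $L$ be a nilpotent SAA of dimension $10$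 and class $7$ with isotropic center of dimension $2$ (then $L^4L^3$ is a $2$-dimensional subspace of $L^6$). Put $I_{1}=L^{5}L^{2}$, $I_{2}=L^{7}$, $I_{3}=L^{6}$, and let $k$ be the smallest index such that $I_{k}\cap L^{4}L^{3}\neq\{0\}$. Then $U=\{x\in L^{4}: xL^{3}\leq I_{k}\}$, a characteristic ideal of dimension $5$. *)

theory Defs
  imports "HOL-Analysis.Analysis"
begin

text \<open>The underlying vector space is the whole type \<open>'v\<close>, over the field type \<open>'a\<close>.\<close>

record ('a, 'v) sympl_struct =
  scl :: "'a \<Rightarrow> 'v \<Rightarrow> 'v"
  mul :: "'v \<Rightarrow> 'v \<Rightarrow> 'v"
  form :: "'v \<Rightarrow> 'v \<Rightarrow> 'a"

locale saa = vector_space "scl L"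
  for L :: "('a::field, 'v::ab_group_add) sympl_struct" +
  assumes finite_dim: "\<exists>B. finite B \<and> span B = UNIV"
    and form_linear_left: "Vector_Spaces.linear (scl L) (*) (\<lambda>x. form L x y)"
    and form_linear_right: "Vector_Spaces.linear (scl L) (*) (\<lambda>y. form L x y)"
    and form_alternating: "form L x x = 0"
    and form_nondegenerate: "(\<And>y. form L x y = 0) \<Longrightarrow> x = 0"
    and mul_linear_left: "Vector_Spaces.linear (scl L) (scl L) (\<lambda>x. mul L x y)"
    and mul_linear_right: "Vector_Spaces.linear (scl L) (scl L) (\<lambda>y. mul L x y)"
    and mul_alternating: "mul L x x = 0"
    and form_mul_cyclic: "form L (mul L x y) z = form L (mul L y z) x"

definition saa_iso ::
  "('a::field, 'v::ab_group_add) sympl_struct \<Rightarrow> ('a, 'w::ab_group_add) sympl_struct \<Rightarrow>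
    ('v \<Rightarrow> 'w) \<Rightarrow> bool" where
  "saa_iso L M f \<longleftrightarrow>
     Vector_Spaces.linear (scl L) (scl M) f \<and> bij f \<and>
     (\<forall>x y. f (mul L x y) = mul M (f x) (f y)) \<and>
     (\<forall>x y. form M (f x) (f y) = form L x y)"

definition saa_isomorphic ::
  "('a::field, 'v::ab_group_add) sympl_struct \<Rightarrow> ('a, 'w::ab_group_add) sympl_struct \<Rightarrow> bool"
  where "saa_isomorphic L M \<longleftrightarrow> (\<exists>f. saa_iso L M f)"

abbreviation sdim :: "('a::field, 'v::ab_group_add) sympl_struct \<Rightarrow> 'v set \<Rightarrow> nat" where
  "sdim L \<equiv> vector_space.dim (scl L)"

definition subprod ::
  "('a::field, 'v::ab_group_add) sympl_struct \<Rightarrow> 'v set \<Rightarrow> 'v set \<Rightarrow> 'v set" where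
  "subprod L A B = module.span (scl L) {mul L a b | a b. a \<in> A \<and> b \<in> B}"

text \<open>The numbering starts at \<open>L\<^sup>1 = L\<close>; the value at \<open>0\<close> is a dummy.\<close>

primrec lcs :: "('a::field, 'v::ab_group_add) sympl_struct \<Rightarrow> nat \<Rightarrow> 'v set" where
  "lcs L 0 = UNIV"
| "lcs L (Suc k) = (if k = 0 then UNIV else subprod L (lcs L k) UNIV)"

definition saa_nilpotent :: "('a::field, 'v::ab_group_add) sympl_struct \<Rightarrow> bool" where
  "saa_nilpotent L \<longleftrightarrow> (\<exists>k. lcs L (Suc k) = {0})"

definition nil_class :: "('a::field, 'v::ab_group_add) sympl_struct \<Rightarrow> nat" where
  "nil_class L = (LEAST k. lcs L (Suc k) = {0})"

definition saa_center :: "('a::field, 'v::ab_group_add) sympl_struct \<Rightarrow> 'v set" where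
  "saa_center L = {z. \<forall>x. mul L z x = 0}"

definition isotropic :: "('a::field, 'v::ab_group_add) sympl_struct \<Rightarrow> 'v set \<Rightarrow> bool" where
  "isotropic L A \<longleftrightarrow> (\<forall>u\<in>A. \<forall>v\<in>A. form L u v = 0)"

definition char_I :: "('a::field, 'v::ab_group_add) sympl_struct \<Rightarrow> nat \<Rightarrow> 'v set" where
  "char_I L k =
     (if k = 1 then subprod L (lcs L 5) (lcs L 2) else if k = 2 then lcs L 7 else lcs L 6)"

text \<open>Meaningful only if some \<open>char_I L k\<close> with \<open>1 \<le> k \<le> 3\<close> meets \<open>L\<^sup>4L\<^sup>3\<close> nontrivially,
  as is the case for nilpotent algebras of dimension 10 and class 7 with isotropic center of
  dimension 2.\<close>

definition char_U :: "('a::field, 'v::ab_group_add) sympl_struct \<Rightarrow> 'v set" where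
  "char_U L =
     (let k = (LEAST k. k \<in> {1..3} \<and> char_I L k \<inter> subprod L (lcs L 4) (lcs L 3) \<noteq> {0})
      in {x \<in> lcs L 4. \<forall>y \<in> lcs L 3. mul L x y \<in> char_I L k})"

text \<open>Presentations are lists of triples \<open>(u, v, w)\<close> of basis symbols together with the
  values of \<open>(uv, w)\<close>.\<close>

datatype bsym = X nat | Y nat

definition bsyms :: "nat \<Rightarrow> bsym set" where
  "bsyms n = X ` {1..n} \<union> Y ` {1..n}"

definition standard_basis ::
  "('a::field, 'v::ab_group_add) sympl_struct \<Rightarrow> nat \<Rightarrow> (bsym \<Rightarrow> 'v) \<Rightarrow> bool" where
  "standard_basis L n e \<longleftrightarrow>
     inj_on e (bsyms n) \<and>
     \<not> module.dependent (scl L) (e ` bsyms n) \<and>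
     module.span (scl L) (e ` bsyms n) = UNIV \<and>
     (\<forall>i\<in>{1..n}. \<forall>j\<in>{1..n}.
        form L (e (X i)) (e (X j)) = 0 \<and>
        form L (e (Y i)) (e (Y j)) = 0 \<and>
        form L (e (X i)) (e (Y j)) = (if i = j then 1 else 0))"

type_synonym 'a presentation = "((bsym \<times> bsym \<times> bsym) \<times> 'a) list"

text \<open>A triple of basis vectors whose value does not follow from a listed one by the alternating
  property is one that is not a permutation of a listed triple.\<close>

definition presented_by ::
  "('a::field, 'v::ab_group_add) sympl_struct \<Rightarrow> nat \<Rightarrow> 'a presentation \<Rightarrow> bool" where
  "presented_by L n P \<longleftrightarrow>
     (\<exists>e. standard_basis L n e \<and>
        (\<forall>((u, v, w), c) \<in> set P. form L (mul L (e u) (e v)) (e w) = c) \<and>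
        (\<forall>u \<in> bsyms n. \<forall>v \<in> bsyms n. \<forall>w \<in> bsyms n.
           (\<forall>((u', v', w'), c) \<in> set P. mset [u, v, w] \<noteq> mset [u', v', w']) \<longrightarrow>
           form L (mul L (e u) (e v)) (e w) = 0))"

definition P10_2_4 :: "'a::field \<Rightarrow> 'a presentation" where
  "P10_2_4 r =
     [((X 3, Y 4, Y 5), r),
      ((X 2, Y 3, Y 5), 1),
      ((X 1, Y 2, Y 5), 1),
      ((X 1, Y 3, Y 4), 1),
      ((Y 1, Y 2, Y 4), 1)]"

definition unit_powers :: "nat \<Rightarrow> 'a::field set" where
  "unit_powers m = {a ^ m | a. a \<noteq> 0}"

definition has_stated_properties ::
  "('a::field, 'v::ab_group_add) sympl_struct \<Rightarrow> bool" where
  "has_stated_properties L \<longleftrightarrow>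
     sdim L UNIV = 10 \<and>
     saa_nilpotent L \<and> nil_class L = 7 \<and>
     isotropic L (saa_center L) \<and> sdim L (saa_center L) = 2 \<and>
     subprod L (lcs L 4) (lcs L 3) = lcs L 7 \<and>
     sdim L (subprod L (char_U L) (lcs L 2)) = 2"

end

theory Submission
  imports Defs
begin

text \<open>
  Write \<open>p = uv\<close>, \<open>q = pv\<close>, \<open>n = qu\<close>, \<open>m = qv\<close> for vectors \<open>u, v\<close> generating the algebra
  modulo \<open>L\<^sup>2\<close>. The stated properties force the dimensions 10, 8, 7, 6 of \<open>L\<close>, \<open>L\<^sup>2\<close>, \<open>L\<^sup>3\<close>, \<open>L\<^sup>4\<close>,
  so \<open>u\<close> can be chosen with \<open>pu\<close> in \<open>L\<^sup>4\<close>. Then \<open>\<alpha> = (n, m)\<close> is nonzero because \<open>L\<^sup>4\<close> is not isotropic,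
  and \<open>\<kappa> = (pu, n)\<close> is nonzero because \<open>dim UL\<^sup>2 = 2\<close>. Changing \<open>v\<close> by multiples of \<open>u\<close> and \<open>p\<close>
  makes \<open>pu\<close> orthogonal to \<open>q\<close> and \<open>m\<close>, and rescaling gives \<open>\<alpha> = \<kappa> = - r\<^sup>2\<close>. In this
  situation \<open>y\<^sub>4 = u\<close>, \<open>y\<^sub>5 = v\<close>, \<open>y\<^sub>3 = - p/r\<close>, \<open>y\<^sub>2 = q/r\<close>, \<open>y\<^sub>1 = - m/r\<close>, \<open>x\<^sub>1 = n/r\<close> and four
  further products form a standard basis with the required presentation. A different choice of
  \<open>u, v\<close> multiplies \<open>\<alpha>\<close> by \<open>a\<^sup>3b\<^sup>5\<close> and \<open>\<kappa>\<close> by \<open>a\<^sup>4b\<^sup>3\<close>, so that \<open>a = b\<^sup>2\<close> and \<open>r\<^sup>2\<close> changes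
  by \<open>b\<^sup>1\<^sup>1\<close>, which means that \<open>r\<close> changes by an eleventh power.
\<close>

section \<open>Bilinear calculus and the lower central series in a symplectic alternating
  algebra\<close>

context saa
begin

text \<open>\<open>finite_dimensional_vector_space\<close> takes a basis as a locale parameter, so
  an arbitrary finite one is fixed to make the dimension lemmas available.\<close>

definition basis0 :: "'v set" where
  "basis0 = (SOME B. finite B \<and> independent B \<and> span B = UNIV)"

lemma basis0: "finite basis0 \<and> independent basis0 \<and> span basis0 = UNIV"
proof -
  obtain S where S: "finite S" "span S = UNIV"
    using finite_dim by auto
  obtain B where "B \<subseteq> S" "independent B" "S \<subseteq> span B"
    using maximal_independent_subset by metis
  moreover have "span B = UNIV"
    using \<open>S \<subseteq> span B\<close> S(2) span_mono span_span by blast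
  ultimately have "\<exists>B. finite B \<and> independent B \<and> span B = UNIV"
    using S(1) finite_subset by blast
  then show ?thesis
    unfolding basis0_def by (rule someI_ex)
qed

sublocale finite_dimensional_vector_space "scl L" basis0
  using basis0 by unfold_locales auto

abbreviation scale_vec (infixr "*\<^sub>L" 75) where "c *\<^sub>L x \<equiv> scl L c x"
abbreviation prod (infixl "\<cdot>" 78) where "x \<cdot> y \<equiv> mul L x y"
abbreviation bform ("\<langle>_, _\<rangle>") where "\<langle>x, y\<rangle> \<equiv> form L x y"
abbreviation lc where "lc \<equiv> lcs L"

lemma form_lin [simp]:
  "\<langle>x + x', y\<rangle> = \<langle>x, y\<rangle> + \<langle>x', y\<rangle>" "\<langle>c *\<^sub>L x, y\<rangle> = c * \<langle>x, y\<rangle>"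
  "\<langle>y, x + x'\<rangle> = \<langle>y, x\<rangle> + \<langle>y, x'\<rangle>" "\<langle>y, c *\<^sub>L x\<rangle> = c * \<langle>y, x\<rangle>"
  using form_linear_left[of y] form_linear_right[of y] by (simp_all add: Vector_Spaces.linear_iff)

lemma mul_lin [simp]:
  "(x + x') \<cdot> y = x \<cdot> y + x' \<cdot> y" "(c *\<^sub>L x) \<cdot> y = c *\<^sub>L (x \<cdot> y)"
  "y \<cdot> (x + x') = y \<cdot> x + y \<cdot> x'" "y \<cdot> (c *\<^sub>L x) = c *\<^sub>L (y \<cdot> x)"
  using mul_linear_left[of y] mul_linear_right[of y] by (simp_all add: Vector_Spaces.linear_iff)

lemma form_lin' [simp]:
  "\<langle>0, y\<rangle> = 0" "\<langle>y, 0\<rangle> = 0" "\<langle>- x, y\<rangle> = - \<langle>x, y\<rangle>" "\<langle>y, - x\<rangle> = - \<langle>y, x\<rangle>"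
  "\<langle>x - x', y\<rangle> = \<langle>x, y\<rangle> - \<langle>x', y\<rangle>" "\<langle>y, x - x'\<rangle> = \<langle>y, x\<rangle> - \<langle>y, x'\<rangle>"
  using form_lin(2)[of 0 0 y] form_lin(4)[of y 0 0] form_lin(2)[of "-1" x y] form_lin(4)[of y "-1" x]
    form_lin(1)[of "x - x'" x' y] form_lin(3)[of y "x - x'" x'] by simp_all

lemma mul_lin' [simp]:
  "0 \<cdot> y = 0" "y \<cdot> 0 = 0" "(- x) \<cdot> y = - (x \<cdot> y)" "y \<cdot> (- x) = - (y \<cdot> x)"
  "(x - x') \<cdot> y = x \<cdot> y - x' \<cdot> y" "y \<cdot> (x - x') = y \<cdot> x - y \<cdot> x'"
  using mul_lin(2)[of 0 0 y] mul_lin(4)[of y 0 0] mul_lin(2)[of "-1" x y] mul_lin(4)[of y "-1" x]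
    mul_lin(1)[of "x - x'" x' y] mul_lin(3)[of y "x - x'" x'] by simp_all

declare form_alternating [simp] mul_alternating [simp]

lemma form_anticomm: "\<langle>x, y\<rangle> = - \<langle>y, x\<rangle>"
  using form_alternating[of "x + y"] by (simp del: form_alternating add: form_alternating[of x] form_alternating[of y] eq_neg_iff_add_eq_0 add.commute)

lemma mul_anticomm: "x \<cdot> y = - (y \<cdot> x)"
  using mul_alternating[of "x + y"] by (simp del: mul_alternating add: mul_alternating[of x] mul_alternating[of y] eq_neg_iff_add_eq_0 add.commute)

text \<open>By non-degeneracy, identities between products can be checked on this alternating
  trilinear form, whose arguments may be permuted freely up to sign.\<close>

definition tri :: "'v \<Rightarrow> 'v \<Rightarrow> 'v \<Rightarrow> 'a" where
  "tri x y z = \<langle>x \<cdot> y, z\<rangle>"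

lemma tri_rot: "tri x y z = tri y z x"
  unfolding tri_def by (rule form_mul_cyclic)

lemma tri_swap: "tri x y z = - tri y x z"
  unfolding tri_def using mul_anticomm[of x y] by simp

lemma tri_swap': "tri x y z = - tri x z y"
  by (metis tri_rot tri_swap)

lemma tri_alt [simp]: "tri x x z = 0" "tri x z x = 0" "tri z x x = 0"
proof -
  show *: "tri x x z = 0" for x z
    by (simp add: tri_def)
  show "tri x z x = 0" "tri z x x = 0"
    using *[of x z] tri_rot by metis+
qed

lemma tri_lin [simp]:
  "tri (x + x') y z = tri x y z + tri x' y z" "tri y (x + x') z = tri y x z + tri y x' z"
  "tri y z (x + x') = tri y z x + tri y z x'"
  "tri (c *\<^sub>L x) y z = c * tri x y z" "tri y (c *\<^sub>L x) z = c * tri y x z"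
  "tri y z (c *\<^sub>L x) = c * tri y z x"
  "tri (- x) y z = - tri x y z" "tri y (- x) z = - tri y x z" "tri y z (- x) = - tri y z x"
  "tri (x - x') y z = tri x y z - tri x' y z" "tri y (x - x') z = tri y x z - tri y x' z"
  "tri y z (x - x') = tri y z x - tri y z x'"
  "tri 0 y z = 0" "tri y 0 z = 0" "tri y z 0 = 0"
  by (simp_all add: tri_def)

lemma form_mul_left: "\<langle>x \<cdot> y, z\<rangle> = tri x y z"
  by (simp add: tri_def)

lemma form_mul_right: "\<langle>z, x \<cdot> y\<rangle> = - tri x y z"
  using form_anticomm[of z] by (simp add: tri_def)

lemma eq_if_forms_eq: "(\<And>y. \<langle>x, y\<rangle> = \<langle>x', y\<rangle>) \<Longrightarrow> x = x'"
  using form_nondegenerate[of "x - x'"] by simp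

lemma subprod_subspace [simp]: "subspace (subprod L A B)"
  by (simp add: subprod_def)

lemma mul_in_subprod: "x \<in> A \<Longrightarrow> y \<in> B \<Longrightarrow> x \<cdot> y \<in> subprod L A B"
  unfolding subprod_def by (rule span_base) blast

lemma subprod_subset:
  assumes "subspace W" "\<And>x y. x \<in> A \<Longrightarrow> y \<in> B \<Longrightarrow> x \<cdot> y \<in> W"
  shows "subprod L A B \<subseteq> W"
  unfolding subprod_def using assms by (intro span_minimal) auto

lemma subprod_mono: "A \<subseteq> A' \<Longrightarrow> B \<subseteq> B' \<Longrightarrow> subprod L A B \<subseteq> subprod L A' B'"
  unfolding subprod_def by (rule span_mono) blast

lemma subspace_perp [simp]: "subspace {x. \<forall>y\<in>S. \<langle>x, y\<rangle> = 0}"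
  by (simp add: subspace_def)

lemma subprod_perp:
  assumes "z \<in> subprod L A B" "\<And>x y. x \<in> A \<Longrightarrow> y \<in> B \<Longrightarrow> tri x y w = 0"
  shows "\<langle>z, w\<rangle> = 0"
proof -
  have "subprod L A B \<subseteq> {x. \<forall>y\<in>{w}. \<langle>x, y\<rangle> = 0}"
    by (rule subprod_subset[OF subspace_perp]) (use assms(2) in \<open>simp add: tri_def\<close>)
  then show ?thesis
    using assms(1) by auto
qed

lemma lc_subspace [simp]: "subspace (lc k)"
  by (cases k) auto

lemma lc_Suc: "k \<noteq> 0 \<Longrightarrow> lc (Suc k) = subprod L (lc k) UNIV"
  by simp

declare lcs.simps [simp del]

lemma lc_0 [simp]: "lc 0 = UNIV" and lc_one [simp]: "lc 1 = UNIV" "lc (Suc 0) = UNIV"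
  by (simp_all add: lcs.simps)

lemma mul_in_lc: "x \<in> lc k \<Longrightarrow> x \<cdot> y \<in> lc (Suc k)"
  by (cases "k = 0") (auto simp: lc_Suc mul_in_subprod)

lemma mul_in_lc': "x \<in> lc k \<Longrightarrow> y \<cdot> x \<in> lc (Suc k)"
  using mul_in_lc[of x k y] mul_anticomm[of y x] subspace_neg[OF lc_subspace] by metis

lemma lc_Suc_subset: "lc (Suc k) \<subseteq> lc k"
proof (induction k)
  case (Suc k)
  show ?case
  proof (cases "k = 0")
    case False
    then show ?thesis
      using subprod_mono[OF Suc order_refl, of UNIV] by (simp add: lc_Suc)
  qed simp
qed simp

lemma lc_antimono: "i \<le> j \<Longrightarrow> lc j \<subseteq> lc i"
  using lift_Suc_antimono_le[of lc i j] lc_Suc_subset by blast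

lemma lc_perp_Suc:
  assumes "k \<noteq> 0" "\<And>x y. x \<in> lc k \<Longrightarrow> tri x y z = 0" "w \<in> lc (Suc k)"
  shows "\<langle>w, z\<rangle> = 0"
  using assms(3) unfolding lc_Suc[OF assms(1)] by (rule subprod_perp) (rule assms(2))

lemma lc_add [intro]: "x \<in> lc k \<Longrightarrow> y \<in> lc k \<Longrightarrow> x + y \<in> lc k"
  and lc_scale [intro]: "x \<in> lc k \<Longrightarrow> c *\<^sub>L x \<in> lc k"
  and lc_diff [intro]: "x \<in> lc k \<Longrightarrow> y \<in> lc k \<Longrightarrow> x - y \<in> lc k"
  and lc_neg [intro]: "x \<in> lc k \<Longrightarrow> - x \<in> lc k"
  and lc_zero [simp]: "0 \<in> lc k"
  by (simp_all add: subspace_add subspace_scale subspace_diff subspace_neg subspace_0)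

end

section \<open>Coordinates in a standard basis and the trilinear form of the presentation\<close>

lemma in_bsyms [simp]: "X i \<in> bsyms n \<longleftrightarrow> 1 \<le> i \<and> i \<le> n" "Y i \<in> bsyms n \<longleftrightarrow> 1 \<le> i \<and> i \<le> n"
  by (auto simp: bsyms_def)

lemma finite_bsyms [simp]: "finite (bsyms n)"
  by (simp add: bsyms_def)

lemma card_bsyms: "card (bsyms n) = 2 * n"
  unfolding bsyms_def
  by (subst card_Un_disjoint) (auto simp: card_image inj_on_def)

text \<open>The determinant of the coordinates of three vectors at three basis symbols: the
  elementary alternating trilinear form belonging to one triple.\<close>

definition det3 :: "(bsym \<Rightarrow> 'a::field) \<Rightarrow> (bsym \<Rightarrow> 'a) \<Rightarrow> (bsym \<Rightarrow> 'a) \<Rightarrow> bsym \<Rightarrow> bsym \<Rightarrow> bsym \<Rightarrow> 'a" where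
  "det3 f g h s t u = f s * (g t * h u - g u * h t) - f t * (g s * h u - g u * h s)
     + f u * (g s * h t - g t * h s)"

text \<open>The trilinear form prescribed by \<open>P10_2_4\<close>, as a function of the
  coordinates: each listed triple contributes its value times its determinant.\<close>

definition presform :: "'a::field \<Rightarrow> (bsym \<Rightarrow> 'a) \<Rightarrow> (bsym \<Rightarrow> 'a) \<Rightarrow> (bsym \<Rightarrow> 'a) \<Rightarrow> 'a" where
  "presform r f g h = r * det3 f g h (X 3) (Y 4) (Y 5) + det3 f g h (X 2) (Y 3) (Y 5)
     + det3 f g h (X 1) (Y 2) (Y 5) + det3 f g h (X 1) (Y 3) (Y 4) + det3 f g h (Y 1) (Y 2) (Y 4)"

lemma mset3_eq:
  "mset [u, v, w] = mset [s, t, q] \<longleftrightarrow>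
    (u, v, w) \<in> {(s, t, q), (s, q, t), (t, s, q), (t, q, s), (q, s, t), (q, t, s)}"
  by (auto simp: add_eq_conv_ex)

text \<open>If the multisets differ, one of the distinct symbols \<open>s\<close>, \<open>t\<close>,
  \<open>q\<close> is missing among \<open>u\<close>, \<open>v\<close>, \<open>w\<close>, and its
  column of the determinant is zero.\<close>

lemma det3_eq_0:
  assumes "mset [u, v, w] \<noteq> mset [s, t, q]" "distinct [s, t, q]"
    and "f = (\<lambda>b. if b = u then 1 else 0)" "g = (\<lambda>b. if b = v then 1 else 0)"
    and "h = (\<lambda>b. if b = w then 1 else 0)"
  shows "det3 f g h s t q = 0"
  using assms(1,2) unfolding mset3_eq assms(3-5) det3_def by auto

context saa
begin

text \<open>For a standard basis this is the coordinate of \<open>w\<close> at the symbol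
  \<open>b\<close>; the order of the arguments in the case \<open>Y\<close> avoids a sign.\<close>

definition crd :: "(bsym \<Rightarrow> 'v) \<Rightarrow> bsym \<Rightarrow> 'v \<Rightarrow> 'a" where
  "crd e b w = (case b of X i \<Rightarrow> \<langle>w, e (Y i)\<rangle> | Y i \<Rightarrow> \<langle>e (X i), w\<rangle>)"

text \<open>The conditions on the form alone; together with the dimension they imply the rest of
  \<open>standard_basis\<close>, see \<open>standard_basisI\<close>.\<close>

definition gram :: "nat \<Rightarrow> (bsym \<Rightarrow> 'v) \<Rightarrow> bool" where
  "gram n e \<longleftrightarrow> (\<forall>i\<in>{1..n}. \<forall>j\<in>{1..n}. \<langle>e (X i), e (X j)\<rangle> = 0 \<and> \<langle>e (Y i), e (Y j)\<rangle> = 0 \<and>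
     \<langle>e (X i), e (Y j)\<rangle> = (if i = j then 1 else 0))"

lemma crd_lin [simp]:
  "crd e b (x + y) = crd e b x + crd e b y" "crd e b (c *\<^sub>L x) = c * crd e b x"
  "crd e b (x - y) = crd e b x - crd e b y" "crd e b (- x) = - crd e b x" "crd e b 0 = 0"
  by (cases b; simp add: crd_def)+

lemma crd_sum: "crd e b (sum g A) = (\<Sum>x\<in>A. crd e b (g x))"
  by (induction A rule: infinite_finite_induct) auto

lemma crd_basis:
  assumes "gram n e" "b \<in> bsyms n" "b' \<in> bsyms n"
  shows "crd e b (e b') = (if b = b' then 1 else 0)"
  using assms by (cases b; cases b') (auto simp: crd_def gram_def)

text \<open>The functionals \<open>crd e b\<close> are dual to the vectors \<open>e b\<close>, which
  gives independence; the span then follows by counting.\<close>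

lemma standard_basisI:
  assumes g: "gram n e" and d: "dim UNIV = 2 * n"
  shows "standard_basis L n e"
proof -
  have inj: "inj_on e (bsyms n)"
    using crd_basis[OF g] by (auto intro!: inj_onI) (metis zero_neq_one)
  have ind: "independent (e ` bsyms n)"
  proof (rule independent_if_scalars_zero)
    fix f x assume s: "(\<Sum>x\<in>e ` bsyms n. f x *\<^sub>L x) = 0" and "x \<in> e ` bsyms n"
    then obtain b where b: "b \<in> bsyms n" "x = e b" by auto
    have "(\<Sum>b\<in>bsyms n. f (e b) *\<^sub>L e b) = 0"
      using s inj by (simp add: sum.reindex)
    then have "crd e b (\<Sum>b\<in>bsyms n. f (e b) *\<^sub>L e b) = 0" by simp
    moreover have "crd e b (\<Sum>b\<in>bsyms n. f (e b) *\<^sub>L e b) = (\<Sum>b'\<in>bsyms n. if b = b' then f (e b') else 0)"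
      unfolding crd_sum by (intro sum.cong refl) (use b crd_basis[OF g] in simp)
    ultimately show "f x = 0"
      using b by simp
  qed simp
  have "UNIV \<subseteq> span (e ` bsyms n)"
    by (rule card_ge_dim_independent[OF _ ind]) (use d inj in \<open>simp_all add: card_image card_bsyms\<close>)
  with inj ind g show ?thesis
    by (auto simp: standard_basis_def gram_def)
qed

lemma standard_basis_gram: "standard_basis L n e \<Longrightarrow> gram n e"
  by (simp add: standard_basis_def gram_def)

lemma dim_standard_basis:
  assumes "standard_basis L n e" shows "dim UNIV = 2 * n"
  using assms dim_span_eq_card_independent[of "e ` bsyms n"]
  by (simp add: standard_basis_def card_image card_bsyms del: dim_UNIV)

text \<open>The hypotheses are plain equations so that simp can discharge them when one argument of
  a trilinear expression varies.\<close>

lemma linear_eq_on_basis: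
  assumes e: "standard_basis L n e"
    and "\<And>x y. f (x + y) = f x + f y" "\<And>c x. f (c *\<^sub>L x) = c * f x"
    and "\<And>x y. g (x + y) = g x + g y" "\<And>c x. g (c *\<^sub>L x) = c * g x"
    and "\<And>b. b \<in> bsyms n \<Longrightarrow> f (e b) = g (e b)"
  shows "f x = (g x :: 'a)"
proof -
  have "x \<in> span (e ` bsyms n)"
    using e by (simp add: standard_basis_def)
  then show ?thesis
  proof (induction rule: span_induct_alt)
    case base
    show ?case
      using assms(3)[of 0 0] assms(5)[of 0 0] by simp
  next
    case (step c x y)
    then show ?case using assms by auto
  qed
qed

lemma eq_if_crd_eq:
  assumes e: "standard_basis L n e" and eq: "\<And>b. b \<in> bsyms n \<Longrightarrow> crd e b x = crd e b y"
  shows "x = y"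
proof (rule eq_if_forms_eq)
  fix z
  have "\<langle>x - y, e b\<rangle> = 0" if "b \<in> bsyms n" for b
  proof (cases b)
    case (X i)
    then show ?thesis
      using eq[of "Y i"] that form_anticomm[of x "e (X i)"] form_anticomm[of y "e (X i)"] by (simp add: crd_def)
  next
    case (Y i)
    then show ?thesis
      using eq[of "X i"] that by (simp add: crd_def)
  qed
  then have "\<langle>x - y, z\<rangle> = 0"
    using linear_eq_on_basis[OF e, of "\<lambda>z. \<langle>x - y, z\<rangle>" "\<lambda>z. 0" z] by simp
  then show "\<langle>x, z\<rangle> = \<langle>y, z\<rangle>" by simp
qed

text \<open>Both sides are trilinear, so comparing them on basis triples is enough. Afterwards every
  computation is a polynomial identity in coordinates.\<close>

lemma presented_imp_presform:
  assumes "presented_by L 5 (P10_2_4 r)"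
  obtains e where "standard_basis L 5 e"
    and "\<And>x y z. tri x y z = presform r (\<lambda>b. crd e b x) (\<lambda>b. crd e b y) (\<lambda>b. crd e b z)"
proof -
  obtain e where e: "standard_basis L 5 e"
    and listed: "tri (e (X 3)) (e (Y 4)) (e (Y 5)) = r" "tri (e (X 2)) (e (Y 3)) (e (Y 5)) = 1"
      "tri (e (X 1)) (e (Y 2)) (e (Y 5)) = 1" "tri (e (X 1)) (e (Y 3)) (e (Y 4)) = 1"
      "tri (e (Y 1)) (e (Y 2)) (e (Y 4)) = 1"
    and other: "\<And>u v w. u \<in> bsyms 5 \<Longrightarrow> v \<in> bsyms 5 \<Longrightarrow> w \<in> bsyms 5 \<Longrightarrow>
      (\<forall>((u', v', w'), c) \<in> set (P10_2_4 r). mset [u, v, w] \<noteq> mset [u', v', w']) \<Longrightarrow>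
      tri (e u) (e v) (e w) = 0"
    using assms unfolding presented_by_def tri_def by (auto simp: P10_2_4_def simp del: mset.simps)
  note cb = crd_basis[OF standard_basis_gram[OF e]]
  let ?F = "\<lambda>x y z. presform r (\<lambda>b. crd e b x) (\<lambda>b. crd e b y) (\<lambda>b. crd e b z)"
  have perm: "tri u v w = k \<Longrightarrow> tri u w v = - k \<and> tri v w u = k \<and> tri v u w = - k \<and> tri w u v = k \<and> tri w v u = - k"
    for u v w k
    by (metis tri_rot tri_swap)
  have basis: "tri (e u) (e v) (e w) = ?F (e u) (e v) (e w)"
    if b: "u \<in> bsyms 5" "v \<in> bsyms 5" "w \<in> bsyms 5" for u v w
  proof (cases "\<forall>((u', v', w'), c) \<in> set (P10_2_4 r). mset [u, v, w] \<noteq> mset [u', v', w']")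
    case True
    have "?F (e u) (e v) (e w) = presform r (\<lambda>b. if b = u then 1 else 0) (\<lambda>b. if b = v then 1 else 0) (\<lambda>b. if b = w then 1 else 0)"
      using cb b by (simp add: presform_def det3_def)
    also have "\<dots> = 0"
      using True by (simp add: presform_def P10_2_4_def det3_eq_0[OF _ _ refl refl refl] del: mset.simps)
    finally show ?thesis
      using other[OF b True] by simp
  next
    case False
    \<comment> \<open>The triple is a permutation of a listed one, and both sides change by the same
      sign.\<close>
    then obtain s t q c where P: "((s, t, q), c) \<in> set (P10_2_4 r)" and m: "mset [u, v, w] = mset [s, t, q]"
      by (auto simp del: mset.simps)
    have *: "s \<in> bsyms 5 \<and> t \<in> bsyms 5 \<and> q \<in> bsyms 5 \<and> tri (e s) (e t) (e q) = c \<and>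
        ?F (e s) (e t) (e q) = c"
      using P listed by (auto simp: P10_2_4_def presform_def det3_def cb)
    have "?F (e s) (e q) (e t) = - c \<and> ?F (e t) (e q) (e s) = c \<and> ?F (e t) (e s) (e q) = - c \<and>
        ?F (e q) (e s) (e t) = c \<and> ?F (e q) (e t) (e s) = - c"
      using * by (auto simp: presform_def det3_def algebra_simps)
    then show ?thesis
      using * perm[of "e s" "e t" "e q" c] m[unfolded mset3_eq] by auto
  qed
  \<comment> \<open>The arguments are extended from basis vectors to all vectors one after the
    other.\<close>
  have 1: "tri x (e v) (e w) = ?F x (e v) (e w)" if b: "v \<in> bsyms 5" "w \<in> bsyms 5" for x v w
    by (rule linear_eq_on_basis[OF e, of "\<lambda>x. tri x (e v) (e w)" "\<lambda>x. ?F x (e v) (e w)"]) (simp_all add: basis b, simp_all add: presform_def det3_def algebra_simps)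
  have 2: "tri x y (e w) = ?F x y (e w)" if b: "w \<in> bsyms 5" for x y w
    by (rule linear_eq_on_basis[OF e, of "\<lambda>y. tri x y (e w)" "\<lambda>y. ?F x y (e w)"]) (simp_all add: 1 b, simp_all add: presform_def det3_def algebra_simps)
  have 3: "tri x y z = ?F x y z" for x y z
    by (rule linear_eq_on_basis[OF e, of "\<lambda>z. tri x y z" "\<lambda>z. ?F x y z"]) (simp_all add: 2, simp_all add: presform_def det3_def algebra_simps)
  show thesis
    using that[OF e 3] .
qed

lemma presented_by_presformI:
  assumes e: "standard_basis L 5 e"
    and tri: "\<And>x y z. tri x y z = presform r (\<lambda>b. crd e b x) (\<lambda>b. crd e b y) (\<lambda>b. crd e b z)"
  shows "presented_by L 5 (P10_2_4 r)"
  unfolding presented_by_def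
proof (intro exI[of _ e] conjI e)
  note cb = crd_basis[OF standard_basis_gram[OF e]]
  show "\<forall>((u, v, w), c)\<in>set (P10_2_4 r). \<langle>e u \<cdot> e v, e w\<rangle> = c"
    by (simp add: P10_2_4_def form_mul_left tri presform_def det3_def cb)
  have "\<langle>e u \<cdot> e v, e w\<rangle> = 0"
    if b: "u \<in> bsyms 5" "v \<in> bsyms 5" "w \<in> bsyms 5"
      and n: "\<forall>((u', v', w'), c)\<in>set (P10_2_4 r). mset [u, v, w] \<noteq> mset [u', v', w']" for u v w
  proof -
    have "\<langle>e u \<cdot> e v, e w\<rangle> = presform r (\<lambda>b. if b = u then 1 else 0) (\<lambda>b. if b = v then 1 else 0)
        (\<lambda>b. if b = w then 1 else 0)"
      using cb b by (simp add: form_mul_left tri presform_def det3_def)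
    also have "\<dots> = 0"
      using n by (simp add: presform_def P10_2_4_def det3_eq_0[OF _ _ refl refl refl] del: mset.simps)
    finally show ?thesis .
  qed
  then show "\<forall>u\<in>bsyms 5. \<forall>v\<in>bsyms 5. \<forall>w\<in>bsyms 5.
      (\<forall>((u', v', w'), c)\<in>set (P10_2_4 r). mset [u, v, w] \<noteq> mset [u', v', w']) \<longrightarrow> \<langle>e u \<cdot> e v, e w\<rangle> = 0"
    by blast
qed

end

section \<open>The presented algebra has the stated properties\<close>

lemma bsyms_5: "bsyms 5 = {X 1, X 2, X 3, X 4, X 5, Y 1, Y 2, Y 3, Y 4, Y 5}"
proof -
  have "{1..5::nat} = {1, 2, 3, 4, 5}" by auto
  then show ?thesis unfolding bsyms_def by auto
qed

locale presented_saa = saa L for L :: "('a::field, 'v::ab_group_add) sympl_struct" +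
  fixes r :: 'a and e :: "bsym \<Rightarrow> 'v"
  assumes r_nonzero [simp]: "r \<noteq> 0"
    and std_basis: "standard_basis L 5 e"
    and tri_presform: "tri x y z = presform r (\<lambda>b. crd e b x) (\<lambda>b. crd e b y) (\<lambda>b. crd e b z)"
begin

declare One_nat_def [simp del]

lemma crd_e [simp]:
  "b \<in> bsyms 5 \<Longrightarrow> b' \<in> bsyms 5 \<Longrightarrow> crd e b (e b') = (if b = b' then 1 else 0)"
  by (rule crd_basis[OF standard_basis_gram[OF std_basis]])

lemma e_nonzero: "b \<in> bsyms 5 \<Longrightarrow> e b \<noteq> 0"
  by (metis crd_e crd_lin(5) zero_neq_one)

lemma vec_eqI: "\<forall>b \<in> bsyms 5. crd e b x = crd e b y \<Longrightarrow> x = y"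
  using eq_if_crd_eq[OF std_basis] by blast

lemma crd_mul_tri:
  "crd e (X i) (a \<cdot> b) = tri a b (e (Y i))" "crd e (Y i) (a \<cdot> b) = - tri a b (e (X i))"
  by (simp_all add: crd_def form_mul_left form_mul_right)

definition minor :: "bsym \<Rightarrow> bsym \<Rightarrow> 'v \<Rightarrow> 'v \<Rightarrow> 'a" where
  "minor s t a b = crd e s a * crd e t b - crd e t a * crd e s b"

text \<open>The \<open>X i\<close> coordinate of a product is its pairing with y_i, the
  \<open>Y i\<close> coordinate minus its pairing with x_i. In the order y_5, ..., y_1, x_1, ...,
  x_5 each coordinate depends only on earlier coordinates of the factors, which makes the algebra
  nilpotent.\<close>

lemma crd_mul [simp]:
  "crd e (Y 5) (a \<cdot> b) = 0" "crd e (Y 4) (a \<cdot> b) = 0"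
  "crd e (Y 3) (a \<cdot> b) = - r * minor (Y 4) (Y 5) a b"
  "crd e (Y 2) (a \<cdot> b) = - minor (Y 3) (Y 5) a b"
  "crd e (Y 1) (a \<cdot> b) = - minor (Y 2) (Y 5) a b - minor (Y 3) (Y 4) a b"
  "crd e (X 1) (a \<cdot> b) = minor (Y 2) (Y 4) a b"
  "crd e (X 2) (a \<cdot> b) = - minor (X 1) (Y 5) a b - minor (Y 1) (Y 4) a b"
  "crd e (X 3) (a \<cdot> b) = - minor (X 2) (Y 5) a b - minor (X 1) (Y 4) a b"
  "crd e (X 4) (a \<cdot> b) = - r * minor (X 3) (Y 5) a b + minor (X 1) (Y 3) a b + minor (Y 1) (Y 2) a b"
  "crd e (X 5) (a \<cdot> b) = r * minor (X 3) (Y 4) a b + minor (X 2) (Y 3) a b + minor (X 1) (Y 2) a b"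
  by (simp_all add: crd_mul_tri tri_presform presform_def det3_def minor_def algebra_simps)

lemma table:
  "e (Y 4) \<cdot> e (Y 5) = - r *\<^sub>L e (Y 3)" "e (Y 3) \<cdot> e (Y 5) = - e (Y 2)"
  "e (Y 3) \<cdot> e (Y 4) = - e (Y 1)"
  "e (Y 2) \<cdot> e (Y 5) = - e (Y 1)" "e (Y 2) \<cdot> e (Y 4) = e (X 1)" "e (Y 1) \<cdot> e (Y 4) = - e (X 2)"
  "e (X 1) \<cdot> e (Y 4) = - e (X 3)" "e (X 3) \<cdot> e (Y 5) = - r *\<^sub>L e (X 4)" "e (X 3) \<cdot> e (Y 4) = r *\<^sub>L e (X 5)"
  "e (X 2) \<cdot> e (Y 5) = - e (X 3)"
  "e (Y 1) \<cdot> e (Y 2) = e (X 4)" "e (X 1) \<cdot> e (Y 2) = e (X 5)" "e (X 1) \<cdot> e (Y 3) = e (X 4)"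
  "e (X 2) \<cdot> e (Y 3) = e (X 5)"
  by (rule vec_eqI, simp add: bsyms_5 minor_def)+

text \<open>Subspaces given by coordinate equations bound the ideals from above, while explicit
  products from \<open>table\<close> bound them from below.\<close>

definition vanishing :: "bsym set \<Rightarrow> 'v set" where
  "vanishing S = {w. \<forall>b\<in>S. crd e b w = 0}"

lemma subspace_vanishing [simp]: "subspace (vanishing S)"
  by (simp add: vanishing_def subspace_def)

lemma subprod_vanishing:
  assumes "\<And>x y b. x \<in> A \<Longrightarrow> y \<in> B \<Longrightarrow> b \<in> S \<Longrightarrow> crd e b (x \<cdot> y) = 0"
  shows "subprod L A B \<subseteq> vanishing S"
  by (rule subprod_subset[OF subspace_vanishing]) (use assms in \<open>simp add: vanishing_def\<close>)

lemma lc_Suc_vanishing: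
  assumes "lc k \<subseteq> vanishing S" "k \<noteq> 0" "n = Suc k"
    and "\<And>a b c. a \<in> vanishing S \<Longrightarrow> c \<in> S' \<Longrightarrow> crd e c (a \<cdot> b) = 0"
  shows "lc n \<subseteq> vanishing S'"
  unfolding assms(3) lc_Suc[OF assms(2)]
  by (rule subprod_vanishing) (use assms(1,4) in blast)

lemma vanishing_bsyms: "vanishing (bsyms 5) = {0}"
  using vec_eqI[of _ 0] by (auto simp: vanishing_def)

lemma lc_vanishing:
  shows lc_2: "lc 2 \<subseteq> vanishing {Y 4, Y 5}"
    and lc_3: "lc 3 \<subseteq> vanishing {Y 3, Y 4, Y 5}"
    and lc_4: "lc 4 \<subseteq> vanishing {Y 2, Y 3, Y 4, Y 5}"
    and lc_5: "lc 5 \<subseteq> vanishing {X 1, Y 1, Y 2, Y 3, Y 4, Y 5}"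
    and lc_6: "lc 6 \<subseteq> vanishing {X 1, X 2, Y 1, Y 2, Y 3, Y 4, Y 5}"
    and lc_7: "lc 7 \<subseteq> vanishing {X 1, X 2, X 3, Y 1, Y 2, Y 3, Y 4, Y 5}"
    and lc_8: "lc 8 = {0}"
proof -
  have 1: "lc 1 \<subseteq> vanishing {}" by (simp add: vanishing_def)
  show 2: "lc 2 \<subseteq> vanishing {Y 4, Y 5}"
    by (rule lc_Suc_vanishing[OF 1]) (auto simp: vanishing_def minor_def)
  show 3: "lc 3 \<subseteq> vanishing {Y 3, Y 4, Y 5}"
    by (rule lc_Suc_vanishing[OF 2]) (auto simp: vanishing_def minor_def)
  show 4: "lc 4 \<subseteq> vanishing {Y 2, Y 3, Y 4, Y 5}"
    by (rule lc_Suc_vanishing[OF 3]) (auto simp: vanishing_def minor_def)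
  show 5: "lc 5 \<subseteq> vanishing {X 1, Y 1, Y 2, Y 3, Y 4, Y 5}"
    by (rule lc_Suc_vanishing[OF 4]) (auto simp: vanishing_def minor_def)
  show 6: "lc 6 \<subseteq> vanishing {X 1, X 2, Y 1, Y 2, Y 3, Y 4, Y 5}"
    by (rule lc_Suc_vanishing[OF 5]) (auto simp: vanishing_def minor_def)
  show 7: "lc 7 \<subseteq> vanishing {X 1, X 2, X 3, Y 1, Y 2, Y 3, Y 4, Y 5}"
    by (rule lc_Suc_vanishing[OF 6]) (auto simp: vanishing_def minor_def)
  have "lc 8 \<subseteq> vanishing (bsyms 5)"
    by (rule lc_Suc_vanishing[OF 7]) (auto simp: bsyms_5 vanishing_def minor_def)
  then show "lc 8 = {0}"
    unfolding vanishing_bsyms by (auto dest: subsetD)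
qed

lemma neg_in_lc [simp]: "- x \<in> lc k \<longleftrightarrow> x \<in> lc k"
  using lc_neg[of "- x" k] lc_neg[of x k] by auto

lemma scale_in_lc [simp]: "c \<noteq> 0 \<Longrightarrow> c *\<^sub>L x \<in> lc k \<longleftrightarrow> x \<in> lc k"
  using lc_scale[of "c *\<^sub>L x" k "inverse c"] lc_scale[of x k c] by auto

text \<open>Starting from y_4 y_5, repeated multiplication by y_4 and y_5 descends through the
  series and reaches all the other basis vectors up to nonzero scalars.\<close>

lemma basis_in_lc:
  "e (Y 3) \<in> lc 2" "e (Y 2) \<in> lc 3" "e (Y 1) \<in> lc 4" "e (X 1) \<in> lc 4"
  "e (X 2) \<in> lc 5" "e (X 3) \<in> lc 6" "e (X 4) \<in> lc 7" "e (X 5) \<in> lc 7"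
proof -
  show 2: "e (Y 3) \<in> lc 2"
    using mul_in_lc[of "e (Y 4)" 1 "e (Y 5)"] by (simp add: table numeral_2_eq_2[symmetric] flip: scale_minus_left)
  show 3: "e (Y 2) \<in> lc 3"
    using mul_in_lc[OF 2, of "e (Y 5)"] by (simp add: table)
  show 4: "e (Y 1) \<in> lc 4" and 5: "e (X 1) \<in> lc 4"
    using mul_in_lc[OF 3, of "e (Y 5)"] mul_in_lc[OF 3, of "e (Y 4)"] by (simp_all add: table)
  show 6: "e (X 2) \<in> lc 5"
    using mul_in_lc[OF 4, of "e (Y 4)"] by (simp add: table)
  show 7: "e (X 3) \<in> lc 6"
    using mul_in_lc[OF 6, of "e (Y 5)"] by (simp add: table)
  show "e (X 4) \<in> lc 7" "e (X 5) \<in> lc 7"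
    using mul_in_lc[OF 7, of "e (Y 5)"] mul_in_lc[OF 7, of "e (Y 4)"]
    by (simp_all add: table flip: scale_minus_left)
qed

text \<open>The span of x_4 and x_5. It turns out to be the center, L^7, L^4 L^3 and U L^2 at
  once.\<close>

definition Zc :: "'v set" where "Zc = vanishing {X 1, X 2, X 3, Y 1, Y 2, Y 3, Y 4, Y 5}"

lemma Zc_subset:
  assumes "subspace W" "e (X 4) \<in> W" "e (X 5) \<in> W"
  shows "Zc \<subseteq> W"
proof
  fix w assume w: "w \<in> Zc"
  have "w = crd e (X 4) w *\<^sub>L e (X 4) + crd e (X 5) w *\<^sub>L e (X 5)"
    by (rule vec_eqI) (use w in \<open>simp add: bsyms_5 Zc_def vanishing_def\<close>)
  then show "w \<in> W"
    using assms subspace_add subspace_scale by metis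
qed

lemma X_in_Zc [simp]: "e (X 4) \<in> Zc" "e (X 5) \<in> Zc"
  by (simp_all add: Zc_def vanishing_def)

lemma dim_Zc: "dim Zc = 2"
proof -
  have "{X 4, X 5} \<subseteq> bsyms 5" by simp
  then have "inj_on e {X 4, X 5}" and "independent (e ` {X 4, X 5})"
    using std_basis inj_on_subset independent_mono image_mono unfolding standard_basis_def by metis+
  then have "dim (span (e ` {X 4, X 5})) = 2"
    by (subst dim_span_eq_card_independent) (auto simp: card_image)
  moreover have "span (e ` {X 4, X 5}) = Zc"
    using Zc_subset[of "span (e ` {X 4, X 5})"] span_minimal[of "e ` {X 4, X 5}" Zc]
    by (auto simp: span_base) (auto simp: Zc_def)
  ultimately show ?thesis by metis
qed

lemma lc_7_eq: "lc 7 = Zc"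
  using lc_7 Zc_subset[of "lc 7"] basis_in_lc by (auto simp: Zc_def)

lemma center_eq: "saa_center L = Zc"
proof
  show "saa_center L \<subseteq> Zc"
  proof
    fix z assume z: "z \<in> saa_center L"
    then have z0: "crd e b (z \<cdot> y) = 0" for b y
      by (simp add: saa_center_def)
    \<comment> \<open>Multiplication by y_4 and y_5 suffices; in this order each equation has one
      coordinate of z left that is not yet known to vanish.\<close>
    have "crd e (Y 5) z = 0" "crd e (Y 4) z = 0"
      using z0[of "Y 3" "e (Y 4)"] z0[of "Y 3" "e (Y 5)"] by (simp_all add: minor_def)
    moreover have "crd e (Y 3) z = 0" "crd e (Y 2) z = 0" "crd e (X 1) z = 0" "crd e (X 2) z = 0"
      using calculation z0[of "Y 2" "e (Y 5)"] z0[of "X 1" "e (Y 4)"] z0[of "X 2" "e (Y 5)"] z0[of "X 3" "e (Y 5)"]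
      by (simp_all add: minor_def)
    moreover have "crd e (Y 1) z = 0" "crd e (X 3) z = 0"
      using calculation z0[of "X 2" "e (Y 4)"] z0[of "X 4" "e (Y 5)"]
      by (simp_all add: minor_def)
    ultimately show "z \<in> Zc" by (simp add: Zc_def vanishing_def)
  qed
  show "Zc \<subseteq> saa_center L"
    using mul_in_lc[of _ 7] lc_8 by (auto simp: saa_center_def simp flip: lc_7_eq)
qed

lemma nil_class_eq: "saa_nilpotent L" "nil_class L = 7"
proof -
  have 8: "lc (Suc 7) = {0}" using lc_8 by simp
  then show "saa_nilpotent L" unfolding saa_nilpotent_def by blast
  have ne: "e (X 4) \<noteq> 0"
    by (rule e_nonzero) simp
  have "7 \<le> k" if "lc (Suc k) = {0}" for k
  proof (rule ccontr)
    assume "\<not> 7 \<le> k"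
    then have "lc 7 \<subseteq> {0}"
      unfolding that[symmetric] by (intro lc_antimono) simp
    then show False
      using basis_in_lc(7) ne by blast
  qed
  then show "nil_class L = 7"
    unfolding nil_class_def using 8 by (intro Least_equality) blast+
qed

lemma isotropic_Zc: "isotropic L Zc"
proof -
  have "\<langle>z, w\<rangle> = 0" if "z \<in> Zc" "w \<in> Zc" for z w
  proof -
    have "Zc \<subseteq> {z. \<forall>y\<in>{e (X 4), e (X 5)}. \<langle>z, y\<rangle> = 0}"
      by (rule Zc_subset[OF subspace_perp]) (use standard_basis_gram[OF std_basis] in \<open>auto simp: gram_def\<close>)
    moreover have "Zc \<subseteq> {w. \<langle>z, w\<rangle> = 0}"
      by (rule Zc_subset) (use calculation that(1) in \<open>auto simp: subspace_def\<close>)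
    ultimately show ?thesis using that by blast
  qed
  then show ?thesis by (auto simp: isotropic_def)
qed

lemma subprod_4_3: "subprod L (lc 4) (lc 3) = Zc"
proof
  show "subprod L (lc 4) (lc 3) \<subseteq> Zc"
    unfolding Zc_def by (rule subprod_vanishing, drule subsetD[OF lc_4], drule subsetD[OF lc_3])
      (auto simp: vanishing_def minor_def)
  show "Zc \<subseteq> subprod L (lc 4) (lc 3)"
    using mul_in_subprod[OF basis_in_lc(3) basis_in_lc(2)] mul_in_subprod[OF basis_in_lc(4) basis_in_lc(2)]
    by (intro Zc_subset) (simp_all add: table)
qed

text \<open>This is the line of x_5: between L^5 and L^2 only the product x_2 y_3 = x_5
  survives.\<close>

lemma char_I_1: "char_I L 1 = vanishing (bsyms 5 - {X 5})"
proof -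
  have "subprod L (lc 5) (lc 2) = vanishing (bsyms 5 - {X 5})"
  proof
    show "subprod L (lc 5) (lc 2) \<subseteq> vanishing (bsyms 5 - {X 5})"
      by (rule subprod_vanishing, drule subsetD[OF lc_5], drule subsetD[OF lc_2])
        (auto simp: bsyms_5 vanishing_def minor_def)
    show "vanishing (bsyms 5 - {X 5}) \<subseteq> subprod L (lc 5) (lc 2)"
    proof
      fix w assume w: "w \<in> vanishing (bsyms 5 - {X 5})"
      have "w = crd e (X 5) w *\<^sub>L e (X 5)"
        by (rule vec_eqI) (use w in \<open>simp add: bsyms_5 vanishing_def\<close>)
      also have "\<dots> = crd e (X 5) w *\<^sub>L (e (X 2) \<cdot> e (Y 3))" by (simp add: table)
      also have "\<dots> \<in> subprod L (lc 5) (lc 2)"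
        by (intro subspace_scale mul_in_subprod basis_in_lc subprod_subspace)
      finally show "w \<in> subprod L (lc 5) (lc 2)" .
    qed
  qed
  then show ?thesis by (simp add: char_I_def)
qed

text \<open>As x_5 also lies in L^4 L^3, the least index in the definition of U is 1.\<close>

lemma char_U_eq: "char_U L = {x \<in> lc 4. \<forall>y \<in> lc 3. x \<cdot> y \<in> vanishing (bsyms 5 - {X 5})}"
proof -
  have "e (X 5) \<in> char_I L 1 \<inter> subprod L (lc 4) (lc 3)"
    by (simp add: char_I_1 subprod_4_3) (auto simp: bsyms_5 vanishing_def)
  moreover have "e (X 5) \<noteq> 0"
    by (rule e_nonzero) simp
  ultimately have "(LEAST k. k \<in> {1..3} \<and> char_I L k \<inter> subprod L (lc 4) (lc 3) \<noteq> {0}) = 1"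
    by (intro Least_equality) auto
  then show ?thesis
    unfolding char_U_def Let_def by (simp only: char_I_1)
qed

lemma subprod_U_2: "subprod L (char_U L) (lc 2) = Zc"
proof
  \<comment> \<open>The vector y_1 is excluded from U because y_1 y_2 = x_4 is outside the line of
    x_5. Without this coordinate, products with L^2 stay in \<open>Zc\<close>.\<close>
  have "crd e (Y 1) x = 0" if "x \<in> char_U L" for x
  proof -
    have "x \<cdot> e (Y 2) \<in> vanishing (bsyms 5 - {X 5})" and "x \<in> lc 4" and "X 4 \<in> bsyms 5 - {X 5}"
      using that basis_in_lc(2) by (auto simp: char_U_eq)
    then have "crd e (X 4) (x \<cdot> e (Y 2)) = 0" "crd e (Y 2) x = 0" "crd e (Y 3) x = 0" "crd e (Y 5) x = 0"
      using lc_4 unfolding vanishing_def by blast+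
    then show ?thesis
      by (simp add: minor_def)
  qed
  then have "crd e b (x \<cdot> y) = 0"
    if "x \<in> char_U L" "y \<in> lc 2" "b \<in> {X 1, X 2, X 3, Y 1, Y 2, Y 3, Y 4, Y 5}" for x y b
    using that subsetD[OF lc_4, of x] subsetD[OF lc_2, of y]
    by (auto simp: char_U_eq vanishing_def minor_def)
  then show "subprod L (char_U L) (lc 2) \<subseteq> Zc"
    unfolding Zc_def by (rule subprod_vanishing)
  \<comment> \<open>Conversely x_1 and x_2 belong to U, and their products with y_3 are x_4 and
    x_5.\<close>
  have "e (X 1) \<cdot> y \<in> vanishing (bsyms 5 - {X 5}) \<and> e (X 2) \<cdot> y \<in> vanishing (bsyms 5 - {X 5})"
    if "y \<in> lc 3" for y
    using subsetD[OF lc_3 that] by (auto simp: bsyms_5 vanishing_def minor_def)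
  then have "e (X 1) \<in> char_U L" "e (X 2) \<in> char_U L"
    using basis_in_lc lc_antimono[of 4 5] by (auto simp: char_U_eq)
  then show "Zc \<subseteq> subprod L (char_U L) (lc 2)"
    using mul_in_subprod[of "e (X 1)" "char_U L" "e (Y 3)" "lc 2"]
      mul_in_subprod[of "e (X 2)" "char_U L" "e (Y 3)" "lc 2"] basis_in_lc(1)
    by (intro Zc_subset) (simp_all add: table)
qed

lemma has_stated_properties: "has_stated_properties L"
  unfolding has_stated_properties_def
  using dim_standard_basis[OF std_basis] nil_class_eq isotropic_Zc dim_Zc
  by (simp add: center_eq subprod_4_3 subprod_U_2 lc_7_eq del: dim_UNIV)

end

section \<open>Normal pairs and the parameter r up to eleventh powers\<close>

definition (in saa) normal_pair :: "'a \<Rightarrow> 'v \<Rightarrow> 'v \<Rightarrow> bool" where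
  "normal_pair r u v \<longleftrightarrow> r \<noteq> 0 \<and> \<langle>u, v\<rangle> = 0 \<and> u \<cdot> v \<cdot> u \<in> lc 4 \<and>
     \<langle>u \<cdot> v \<cdot> v \<cdot> u, u \<cdot> v \<cdot> v \<cdot> v\<rangle> = - r\<^sup>2 \<and> \<langle>u \<cdot> v \<cdot> u, u \<cdot> v \<cdot> v \<cdot> u\<rangle> = - r\<^sup>2 \<and>
     \<langle>u \<cdot> v \<cdot> u, u \<cdot> v \<cdot> v\<rangle> = 0 \<and> \<langle>u \<cdot> v \<cdot> u, u \<cdot> v \<cdot> v \<cdot> v\<rangle> = 0"

text \<open>With a = c^4 and b = c^2 one has a^3 b^5 = a^4 b^3 = c^22, so r^2 is multiplied by the
  square of c^11. That \<open>normal_pair\<close> sees r only through r^2 does no harm, because -1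
  is an eleventh power.\<close>

lemma (in saa) normal_pair_scale:
  assumes "normal_pair r u v" "c \<noteq> 0"
  shows "normal_pair (r * c ^ 11) (c ^ 4 *\<^sub>L u) (c\<^sup>2 *\<^sub>L v)"
  using assms by (auto simp: normal_pair_def power_mult_distrib algebra_simps simp flip: power_mult power_add
      intro!: lc_scale)

context presented_saa
begin

declare One_nat_def [simp del]

lemma normal_pair_basis: "normal_pair r (e (Y 4)) (e (Y 5))"
proof -
  have "\<langle>e (Y 4), e (Y 5)\<rangle> = 0" "\<langle>e (Y 1), e (Y 1)\<rangle> = 0" "\<langle>e (Y 1), e (Y 2)\<rangle> = 0"
    "\<langle>e (X 1), e (Y 1)\<rangle> = 1" "\<langle>e (Y 1), e (X 1)\<rangle> = - 1"
    using standard_basis_gram[OF std_basis] form_anticomm[of "e (Y 1)" "e (X 1)"] by (simp_all add: gram_def)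
  then show ?thesis
    using basis_in_lc by (auto simp: normal_pair_def table power2_eq_square simp del: scale_minus_left intro!: lc_scale lc_neg)
qed

lemma form_crd:
  "\<langle>a, b\<rangle> = (\<Sum>i\<in>{1, 2, 3, 4, 5}. crd e (X i) a * crd e (Y i) b - crd e (Y i) a * crd e (X i) b)"
proof -
  have "b = (\<Sum>i\<in>{1, 2, 3, 4, 5}. crd e (X i) b *\<^sub>L e (X i) + crd e (Y i) b *\<^sub>L e (Y i))"
    by (rule vec_eqI) (simp add: bsyms_5)
  then have "\<langle>a, b\<rangle> = \<langle>a, \<Sum>i\<in>{1, 2, 3, 4, 5}. crd e (X i) b *\<^sub>L e (X i) + crd e (Y i) b *\<^sub>L e (Y i)\<rangle>"
    by simp
  moreover have "\<langle>a, e (Y i)\<rangle> = crd e (X i) a" "\<langle>a, e (X i)\<rangle> = - crd e (Y i) a" for i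
    using form_anticomm[of a "e (X i)"] by (simp_all add: crd_def)
  ultimately show ?thesis
    by (simp add: algebra_simps)
qed

text \<open>For i > 1 each term of the coordinate formula contains a \<open>Y i\<close> coordinate,
  and these vanish on L^4.\<close>

lemma form_lc_4:
  assumes "a \<in> lc 4" "b \<in> lc 4"
  shows "\<langle>a, b\<rangle> = crd e (X 1) a * crd e (Y 1) b - crd e (Y 1) a * crd e (X 1) b"
  using subsetD[OF lc_4 assms(1)] subsetD[OF lc_4 assms(2)] by (simp add: form_crd vanishing_def)

text \<open>The algebra has parameter r and the pair has parameter s. Both values of the pair are
  computed in coordinates, where only the y_4 coordinate of u and the y_5 coordinate of v
  survive.\<close>

lemma normal_pair_unique:
  assumes "normal_pair s u v"
  shows "s / r \<in> unit_powers 11"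
proof -
  define a b where "a = crd e (Y 4) u" and "b = crd e (Y 5) v"
  have s: "s \<noteq> 0" and f: "u \<cdot> v \<cdot> u \<in> lc 4"
    and alpha: "\<langle>u \<cdot> v \<cdot> v \<cdot> u, u \<cdot> v \<cdot> v \<cdot> v\<rangle> = - s\<^sup>2"
    and kappa: "\<langle>u \<cdot> v \<cdot> u, u \<cdot> v \<cdot> v \<cdot> u\<rangle> = - s\<^sup>2"
    using assms by (auto simp: normal_pair_def)
  have lc: "u \<cdot> v \<cdot> v \<cdot> w \<in> lc 4" for w
    using mul_in_lc[OF mul_in_lc[OF mul_in_lc[of u 1]], of v v w] by simp
  \<comment> \<open>This coordinate is r times the minor of u and v times the y_5 coordinate of u,
    and it vanishes on L^4.\<close>
  have "crd e (Y 2) (u \<cdot> v \<cdot> u) = 0"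
    using subsetD[OF lc_4 f] by (simp add: vanishing_def)
  then have "minor (Y 4) (Y 5) u v = 0 \<or> crd e (Y 5) u = 0"
    by (simp add: minor_def[of "Y 3"])
  moreover have "minor (Y 4) (Y 5) u v \<noteq> 0"
  proof
    assume "minor (Y 4) (Y 5) u v = 0"
    \<comment> \<open>With zero minor, uv has no y_3 coordinate, so (uv)v has no y_2 coordinate and
      ((uv)v)u has no x_1 or y_1 coordinate.\<close>
    then have "\<langle>u \<cdot> v \<cdot> u, u \<cdot> v \<cdot> v \<cdot> u\<rangle> = 0"
      by (simp add: form_lc_4[OF f lc]) (simp add: minor_def)
    then show False using kappa s by simp
  qed
  ultimately have u5: "crd e (Y 5) u = 0" by blast
  then have minor: "minor (Y 4) (Y 5) u v = a * b"
    by (simp add: minor_def a_def b_def)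
  have minor_0: "minor (Y 4) (Y 5) (u \<cdot> v) w = 0" for w
    by (simp add: minor_def)
  \<comment> \<open>The pair has the same two values as (a y_4, b y_5), which are those of (y_4,
    y_5) rescaled.\<close>
  have "- s\<^sup>2 = - (r\<^sup>2 * (a ^ 3 * b ^ 5))"
    unfolding alpha[symmetric] form_lc_4[OF lc lc]
    by (simp add: minor_def[of "Y 2"] minor_def[of "Y 3"] minor minor_0 u5 flip: a_def b_def)
       (simp add: power_numeral_reduce algebra_simps)
  moreover have "- s\<^sup>2 = - (r\<^sup>2 * (a ^ 4 * b ^ 3))"
    unfolding kappa[symmetric] form_lc_4[OF f lc]
    by (simp add: minor_def[of "Y 2"] minor_def[of "Y 3"] minor minor_0 u5 flip: a_def b_def)
       (simp add: power_numeral_reduce algebra_simps)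
  ultimately have 1: "s\<^sup>2 = r\<^sup>2 * (a ^ 3 * b ^ 5)" and "a ^ 3 * b ^ 5 = a ^ 4 * b ^ 3"
    by simp_all
  then have "a ^ 3 * b ^ 3 * (b\<^sup>2 - a) = 0"
    by (simp add: power_numeral_reduce algebra_simps)
  moreover have ab: "a \<noteq> 0" "b \<noteq> 0"
    using 1 s by auto
  ultimately have "a = b\<^sup>2" by simp
  then have "(s / r)\<^sup>2 = b ^ 11"
    using 1 by (simp add: power_divide flip: power_mult power_add)
  \<comment> \<open>An eleventh root is extracted using 11 = 2 * 5 + 1: the fifth power of (s/r)^2 =
    b^11 times s/r gives (s/r)^11 = b^55 (s/r).\<close>
  then have "((s / r)\<^sup>2) ^ 5 = b ^ 55" by (simp flip: power_mult)
  then have "(s / r / b ^ 5) ^ 11 = s / r"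
    using ab s unfolding power_divide[of _ "b ^ 5"]
    by (simp flip: power_mult) (simp add: power_numeral_reduce)
  then show ?thesis
    using s ab unfolding unit_powers_def by (auto intro!: exI[of _ "s / r / b ^ 5"])
qed

end

section \<open>From a normal pair to a standard basis with the required presentation\<close>

lemma wlog_sorted_triple:
  fixes rank :: "'b \<Rightarrow> 'c::linorder"
  assumes "\<And>u v w. Q u v w \<Longrightarrow> Q v u w" "\<And>u v w. Q u v w \<Longrightarrow> Q u w v" "\<And>u w. Q u u w"
    and "\<And>u v. rank u = rank v \<Longrightarrow> u = v"
    and sorted: "\<And>u v w. rank u < rank v \<Longrightarrow> rank v < rank w \<Longrightarrow> Q u v w"
  shows "Q u v w"
proof (cases "u = v \<or> v = w \<or> u = w")
  case True
  then show ?thesis using assms(1-3) by metis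
next
  case False
  then have "rank u \<noteq> rank v" "rank v \<noteq> rank w" "rank u \<noteq> rank w"
    using assms(4) by blast+
  then consider "rank u < rank v" "rank v < rank w" | "rank u < rank w" "rank w < rank v"
    | "rank v < rank u" "rank u < rank w" | "rank v < rank w" "rank w < rank u"
    | "rank w < rank u" "rank u < rank v" | "rank w < rank v" "rank v < rank u"
    by (metis linorder_neqE)
  then show ?thesis
    using sorted assms(1,2) by cases metis+
qed

text \<open>This orders the symbols as y_5, ..., y_1, x_1, ..., x_5. In the basis built below, the
  symbols of rank at least -2, the rank of y_1, give vectors of L^4.\<close>

definition rank :: "bsym \<Rightarrow> int" where
  "rank b = (case b of X i \<Rightarrow> int i | Y i \<Rightarrow> - int i - 1)"

locale class7_saa = saa L for L :: "('a::field, 'v::ab_group_add) sympl_struct" +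
  assumes dim_10: "dim UNIV = 10"
    and lc_8: "lc 8 = {0}"
    and lc_4_3: "subprod L (lc 4) (lc 3) = lc 7"
begin

declare One_nat_def [simp del]

text \<open>By (zw, x) = (wx, z), orthogonality of L^a and L^(b+1) reduces to that of L^(a+1) and
  L^b; the descent ends with L^8 = 0.\<close>

lemma lc_perp:
  assumes "x \<in> lc a" "y \<in> lc b" "a + b \<ge> 9" "a \<noteq> 0" "b \<noteq> 0"
  shows "\<langle>x, y\<rangle> = 0"
  using assms
proof (induction b arbitrary: x y a)
  case (Suc b)
  show ?case
  proof (cases "b = 0")
    case True
    then have "lc a \<subseteq> {0}"
      using Suc.prems lc_antimono[of 8 a] lc_8 by simp
    then show ?thesis using Suc.prems by auto
  next
    case False
    have "\<langle>y, x\<rangle> = 0"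
    proof (rule lc_perp_Suc[OF False _ Suc.prems(2)])
      fix z w assume z: "z \<in> lc b"
      have "\<langle>w \<cdot> x, z\<rangle> = 0"
        using Suc.prems False by (intro Suc.IH[of _ "Suc a"] z mul_in_lc') auto
      then show "tri z w x = 0"
        by (metis tri_def tri_rot)
    qed
    then show ?thesis
      using form_anticomm[of x y] by simp
  qed
qed simp

text \<open>In (xy, z) = (zx, y) the factor zx has gained one step in the series, so 8 suffices
  instead of 9.\<close>

lemma lc_mul_0:
  assumes "x \<in> lc a" "y \<in> lc b" "a + b \<ge> 8" "a \<noteq> 0" "b \<noteq> 0"
  shows "x \<cdot> y = 0"
proof (rule eq_if_forms_eq)
  fix z
  have "\<langle>z \<cdot> x, y\<rangle> = 0"
    using assms by (intro lc_perp[of _ "Suc a" _ b] mul_in_lc') auto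
  then show "\<langle>x \<cdot> y, z\<rangle> = \<langle>0, z\<rangle>"
    by (simp add: form_mul_left) (metis tri_rot)
qed

text \<open>This is how the hypothesis L^4 L^3 = L^7 enters: L^7 is orthogonal to L^2.\<close>

lemma tri_4_3_2:
  assumes "x \<in> lc 4" "y \<in> lc 3" "z \<in> lc 2"
  shows "tri x y z = 0"
proof -
  have "x \<cdot> y \<in> lc 7"
    using mul_in_subprod[OF assms(1,2)] lc_4_3 by simp
  then show ?thesis
    unfolding tri_def by (rule lc_perp[OF _ assms(3)]) auto
qed

lemma mul_in_lc_numeral:
  "x \<cdot> y \<in> lc 2" "x \<in> lc 2 \<Longrightarrow> x \<cdot> y \<in> lc 3" "x \<in> lc 3 \<Longrightarrow> x \<cdot> y \<in> lc 4"
  "x \<in> lc 4 \<Longrightarrow> x \<cdot> y \<in> lc 5" "x \<in> lc 5 \<Longrightarrow> x \<cdot> y \<in> lc 6" "x \<in> lc 6 \<Longrightarrow> x \<cdot> y \<in> lc 7"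
  "x \<in> lc 7 \<Longrightarrow> x \<cdot> y = 0"
  using mul_in_lc[of x 1 y] mul_in_lc[of x 2 y] mul_in_lc[of x 3 y] mul_in_lc[of x 4 y]
    mul_in_lc[of x 5 y] mul_in_lc[of x 6 y] mul_in_lc[of x 7 y] lc_8 by simp_all

text \<open>Except for y_4 and y_5 all vectors are products up to scalars, so values of the form are
  values of \<open>tri\<close>. Its symmetries and the orthogonality of deep terms of the series
  determine the Gram matrix and then the unlisted triples.\<close>

lemma presentedI:
  fixes e :: "bsym \<Rightarrow> 'v"
  assumes r: "r \<noteq> 0"
    and rel: "e (Y 4) \<cdot> e (Y 5) = - r *\<^sub>L e (Y 3)" "e (Y 3) \<cdot> e (Y 5) = - e (Y 2)"
      "e (Y 2) \<cdot> e (Y 5) = - e (Y 1)" "e (Y 2) \<cdot> e (Y 4) = e (X 1)"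
    and X: "e (X 5) = e (X 1) \<cdot> e (Y 2)" "e (X 4) = e (Y 1) \<cdot> e (Y 2)"
      "e (X 3) = - (e (X 1) \<cdot> e (Y 4))" "e (X 2) = - (e (X 1) \<cdot> e (Y 5))"
    and norm: "\<langle>e (X 1), e (Y 1)\<rangle> = 1" "\<langle>e (Y 4), e (Y 5)\<rangle> = 0"
    and y34: "tri (e (Y 3)) (e (Y 4)) (e (X 1)) = 1" "tri (e (Y 3)) (e (Y 4)) (e (Y 1)) = 0"
      "tri (e (Y 3)) (e (Y 4)) (e (Y 2)) = 0" "e (Y 3) \<cdot> e (Y 4) \<in> lc 4"
  shows "presented_by L 5 (P10_2_4 r)"
proof -
  have Y: "e (Y 3) = - inverse r *\<^sub>L (e (Y 4) \<cdot> e (Y 5))" "e (Y 2) = - (e (Y 3) \<cdot> e (Y 5))"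
    "e (Y 1) = - (e (Y 2) \<cdot> e (Y 5))" "e (X 1) = e (Y 2) \<cdot> e (Y 4)"
    unfolding rel using r by simp_all
  have lc3: "e (Y 3) \<in> lc 2" unfolding Y(1)
    by (intro lc_scale mul_in_lc_numeral)
  have lc2: "e (Y 2) \<in> lc 3" unfolding Y(2)
    by (intro lc_neg mul_in_lc_numeral lc3)
  have lc1: "e (Y 1) \<in> lc 4" "e (X 1) \<in> lc 4" unfolding Y(3,4)
    by (intro lc_neg mul_in_lc_numeral lc2)+
  have lcX: "e (X 2) \<in> lc 5" "e (X 3) \<in> lc 5" "e (X 4) \<in> lc 5" "e (X 5) \<in> lc 5" unfolding X
    by (intro lc_neg mul_in_lc_numeral lc1)+
  have lcX7: "e (X 4) \<in> lc 7" "e (X 5) \<in> lc 7" unfolding X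
    using mul_in_subprod[OF lc1(1) lc2] mul_in_subprod[OF lc1(2) lc2] lc_4_3 by auto
  have lc4: "e (X i) \<in> lc 4" if "i \<in> {2..5}" for i
  proof -
    have "i = 2 \<or> i = 3 \<or> i = 4 \<or> i = 5" using that by auto
    then show ?thesis using lcX lc_antimono[of 4 5] by auto
  qed
  \<comment> \<open>\<open>T\<close>, \<open>FY\<close> and \<open>FX\<close> translate between the
    form and \<open>tri\<close> in both directions; the Gram matrix comes from chasing values
    through permutations of triples.\<close>
  have T: "tri (e (Y 4)) (e (Y 5)) z = - r * \<langle>e (Y 3), z\<rangle>" "tri (e (Y 3)) (e (Y 5)) z = - \<langle>e (Y 2), z\<rangle>"
    "tri (e (Y 2)) (e (Y 5)) z = - \<langle>e (Y 1), z\<rangle>" "tri (e (Y 2)) (e (Y 4)) z = \<langle>e (X 1), z\<rangle>" for z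
    unfolding tri_def rel by simp_all
  have FY: "\<langle>e (Y 3), z\<rangle> = - inverse r * tri (e (Y 4)) (e (Y 5)) z" "\<langle>e (Y 2), z\<rangle> = - tri (e (Y 3)) (e (Y 5)) z"
    "\<langle>e (Y 1), z\<rangle> = - tri (e (Y 2)) (e (Y 5)) z" "\<langle>e (X 1), z\<rangle> = tri (e (Y 2)) (e (Y 4)) z" for z
    unfolding T using r by simp_all
  have FX: "\<langle>e (X 5), z\<rangle> = tri (e (X 1)) (e (Y 2)) z" "\<langle>e (X 4), z\<rangle> = tri (e (Y 1)) (e (Y 2)) z"
    "\<langle>e (X 3), z\<rangle> = - tri (e (X 1)) (e (Y 4)) z" "\<langle>e (X 2), z\<rangle> = - tri (e (X 1)) (e (Y 5)) z" for z
    unfolding tri_def X by simp_all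
  note [simp] = r
  have y3: "\<langle>e (Y 3), e (Y 4)\<rangle> = 0" "\<langle>e (Y 3), e (Y 5)\<rangle> = 0"
    by (simp_all add: FY)
  have y2: "\<langle>e (Y 2), e (Y 3)\<rangle> = 0" "\<langle>e (Y 2), e (Y 5)\<rangle> = 0"
    by (simp_all add: FY(2))
  have y24: "\<langle>e (Y 2), e (Y 4)\<rangle> = 0"
    using T(1)[of "e (Y 3)"] tri_rot[of "e (Y 3)" "e (Y 5)" "e (Y 4)"] tri_swap[of "e (Y 5)" "e (Y 4)" "e (Y 3)"]
    by (simp add: FY(2))
  have y1: "\<langle>e (Y 1), e (Y 2)\<rangle> = 0" "\<langle>e (Y 1), e (Y 5)\<rangle> = 0"
    by (simp_all add: FY(3))
  have y13: "\<langle>e (Y 1), e (Y 3)\<rangle> = 0"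
    using T(2)[of "e (Y 2)"] tri_rot[of "e (Y 3)" "e (Y 5)" "e (Y 2)"] tri_swap[of "e (Y 5)" "e (Y 2)" "e (Y 3)"] by (simp add: FY(3))
  have y32: "\<langle>e (Y 3), e (Y 2)\<rangle> = 0"
    using y2(1) form_anticomm[of "e (Y 3)" "e (Y 2)"] by simp
  have t245: "tri (e (Y 2)) (e (Y 4)) (e (Y 5)) = 0"
    using T(1)[of "e (Y 2)"] tri_rot[of "e (Y 2)" "e (Y 4)" "e (Y 5)"] y32 by simp
  have y14: "\<langle>e (Y 1), e (Y 4)\<rangle> = 0"
    using t245 tri_swap'[of "e (Y 2)" "e (Y 4)" "e (Y 5)"] by (simp add: FY(3))
  have x1: "\<langle>e (X 1), e (Y 2)\<rangle> = 0" "\<langle>e (X 1), e (Y 4)\<rangle> = 0" "\<langle>e (X 1), e (Y 5)\<rangle> = 0"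
    by (simp_all add: FY(4) t245)
  have x13: "\<langle>e (X 1), e (Y 3)\<rangle> = 0"
    using y34(3) tri_rot[of "e (Y 2)" "e (Y 3)" "e (Y 4)"] tri_swap'[of "e (Y 2)" "e (Y 3)" "e (Y 4)"] by (simp add: FY(4))
  have swap: "\<langle>a, b\<rangle> = 0 \<Longrightarrow> \<langle>b, a\<rangle> = 0" for a b
    using form_anticomm[of a b] by simp
  have x2: "\<langle>e (X 2), e (Y 5)\<rangle> = 0" "\<langle>e (X 2), e (Y 4)\<rangle> = 0" "\<langle>e (X 2), e (Y 3)\<rangle> = 0" "\<langle>e (X 2), e (Y 2)\<rangle> = 1"
  proof -
    show "\<langle>e (X 2), e (Y 5)\<rangle> = 0" by (simp add: FX)
    show "\<langle>e (X 2), e (Y 4)\<rangle> = 0"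
      using T(1)[of "e (X 1)"] swap[OF x13] tri_rot[of "e (X 1)" "e (Y 4)" "e (Y 5)"] tri_swap'[of "e (X 1)" "e (Y 4)" "e (Y 5)"]
      by (simp add: FX)
    show "\<langle>e (X 2), e (Y 3)\<rangle> = 0"
      using T(2)[of "e (X 1)"] swap[OF x1(1)] tri_rot[of "e (X 1)" "e (Y 3)" "e (Y 5)"] tri_swap'[of "e (X 1)" "e (Y 3)" "e (Y 5)"]
      by (simp add: FX)
    show "\<langle>e (X 2), e (Y 2)\<rangle> = 1"
      using T(3)[of "e (X 1)"] norm(1) form_anticomm[of "e (X 1)" "e (Y 1)"] tri_rot[of "e (X 1)" "e (Y 2)" "e (Y 5)"] tri_swap'[of "e (X 1)" "e (Y 2)" "e (Y 5)"]
      by (simp add: FX)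
  qed
  have x3: "\<langle>e (X 3), e (Y 5)\<rangle> = 0" "\<langle>e (X 3), e (Y 4)\<rangle> = 0" "\<langle>e (X 3), e (Y 3)\<rangle> = 1" "\<langle>e (X 3), e (Y 2)\<rangle> = 0"
  proof -
    show "\<langle>e (X 3), e (Y 5)\<rangle> = 0"
      using T(1)[of "e (X 1)"] swap[OF x13] tri_rot[of "e (X 1)" "e (Y 4)" "e (Y 5)"] by (simp add: FX)
    show "\<langle>e (X 3), e (Y 4)\<rangle> = 0" by (simp add: FX)
    show "\<langle>e (X 3), e (Y 3)\<rangle> = 1"
      using y34(1) tri_rot[of "e (X 1)" "e (Y 3)" "e (Y 4)"] tri_swap'[of "e (X 1)" "e (Y 3)" "e (Y 4)"] by (simp add: FX)
    show "\<langle>e (X 3), e (Y 2)\<rangle> = 0"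
      using T(4)[of "e (X 1)"] tri_rot[of "e (X 1)" "e (Y 2)" "e (Y 4)"] tri_swap'[of "e (X 1)" "e (Y 2)" "e (Y 4)"]
      by (simp add: FX)
  qed
  have x4: "\<langle>e (X 4), e (Y 5)\<rangle> = 0" "\<langle>e (X 4), e (Y 4)\<rangle> = 1" "\<langle>e (X 4), e (Y 2)\<rangle> = 0"
  proof -
    show "\<langle>e (X 4), e (Y 5)\<rangle> = 0"
      using T(3)[of "e (Y 1)"] tri_rot[of "e (Y 1)" "e (Y 2)" "e (Y 5)"] by (simp add: FX)
    show "\<langle>e (X 4), e (Y 4)\<rangle> = 1"
      using T(4)[of "e (Y 1)"] norm tri_rot[of "e (Y 1)" "e (Y 2)" "e (Y 4)"] by (simp add: FX)
    show "\<langle>e (X 4), e (Y 2)\<rangle> = 0" by (simp add: FX)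
  qed
  have x5: "\<langle>e (X 5), e (Y 5)\<rangle> = 1" "\<langle>e (X 5), e (Y 4)\<rangle> = 0" "\<langle>e (X 5), e (Y 2)\<rangle> = 0"
  proof -
    show "\<langle>e (X 5), e (Y 5)\<rangle> = 1"
      using T(3)[of "e (X 1)"] norm(1) form_anticomm[of "e (X 1)" "e (Y 1)"] tri_rot[of "e (X 1)" "e (Y 2)" "e (Y 5)"] by (simp add: FX)
    show "\<langle>e (X 5), e (Y 4)\<rangle> = 0"
      using T(4)[of "e (X 1)"] tri_rot[of "e (X 1)" "e (Y 2)" "e (Y 4)"] by (simp add: FX)
    show "\<langle>e (X 5), e (Y 2)\<rangle> = 0" by (simp add: FX)
  qed
  have xy3: "\<langle>e (X 4), e (Y 3)\<rangle> = 0" "\<langle>e (X 5), e (Y 3)\<rangle> = 0"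
    using lcX7 lc3 by (auto intro: lc_perp[of _ 7 _ 2])
  have lc5: "e (X i) \<in> lc 5" if "i \<in> {2..5}" for i
  proof -
    have "i = 2 \<or> i = 3 \<or> i = 4 \<or> i = 5" using that by auto
    then show ?thesis using lcX by auto
  qed
  have xx: "\<langle>e (X i), e (X j)\<rangle> = 0" if "i \<in> {2..5}" "j \<in> {2..5}" for i j
    using lc5[OF that(1)] lc4[OF that(2)] by (rule lc_perp) auto
  have x1x: "\<langle>e (X i), e (X 1)\<rangle> = 0" "\<langle>e (X i), e (Y 1)\<rangle> = 0" "\<langle>e (X 1), e (X i)\<rangle> = 0"
    if "i \<in> {2..5}" for i
    using lc5[OF that] lc1 by (auto intro: lc_perp[of _ 5 _ 4] lc_perp[of _ 4 _ 5])
  have gram: "gram 5 e"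
  proof -
    have I: "{1..5::nat} = {1, 2, 3, 4, 5}" by auto
    show ?thesis
      unfolding gram_def I
      using y3 y2 y24 y1 y13 y14 norm x1 x13 x2 x3 x4 x5 xy3 xx x1x
        y3[THEN swap] y2[THEN swap] y24[THEN swap] y1[THEN swap] y13[THEN swap] y14[THEN swap] norm(2)[THEN swap]
      by simp
  qed
  have std: "standard_basis L 5 e"
    using gram dim_10 by (intro standard_basisI) auto
  note cb = crd_basis[OF gram]
  \<comment> \<open>A triple vanishes as soon as two of its entries are deep enough for their
    product to be zero: depths 4 and 4, or 3 and 5.\<close>
  have t44: "tri z a b = 0" if "a \<in> lc 4" "b \<in> lc 4" for z a b
    using lc_mul_0[OF that] tri_rot[of z a b] by (simp add: tri_def)
  have t35: "tri z (e (Y 2)) b = 0" if "b \<in> lc 5" for z b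
    using lc_mul_0[OF lc2 that] tri_rot[of z "e (Y 2)" b] by (simp add: tri_def)
  have t24: "tri (e (Y 3)) (e (Y 2)) b = 0" if "b \<in> lc 4" for b
    using tri_4_3_2[OF that lc2 lc3] tri_rot tri_swap by (metis minus_zero)
  have t34: "tri (e (Y 4)) (e (Y 3)) b = 0" if "b \<in> lc 5" for b
    using lc_perp[OF y34(4) that] tri_swap[of "e (Y 4)" "e (Y 3)" b] by (simp add: form_mul_left)
  have swapped: "tri (e (Y 5)) (e (Y 4)) z = r * \<langle>e (Y 3), z\<rangle>" "tri (e (Y 5)) (e (Y 3)) z = \<langle>e (Y 2), z\<rangle>"
    "tri (e (Y 5)) (e (Y 2)) z = \<langle>e (Y 1), z\<rangle>" "tri (e (Y 4)) (e (Y 2)) z = - \<langle>e (X 1), z\<rangle>" for z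
    using T[of z] tri_swap[of "e (Y 5)" "e (Y 4)" z] tri_swap[of "e (Y 5)" "e (Y 3)" z]
      tri_swap[of "e (Y 5)" "e (Y 2)" z] tri_swap[of "e (Y 4)" "e (Y 2)" z] by simp_all
  have y43: "tri (e (Y 4)) (e (Y 3)) (e (Y 2)) = 0" "tri (e (Y 4)) (e (Y 3)) (e (Y 1)) = 0"
    using y34 tri_swap[of "e (Y 4)" "e (Y 3)"] by simp_all
  have yX: "\<langle>e (Y i), e (X j)\<rangle> = (if i = j then - 1 else 0)" if "i \<in> {1..5}" "j \<in> {1..5}" for i j
    using gram that form_anticomm[of "e (Y i)" "e (X j)"] by (simp add: gram_def)
  have yy: "\<langle>e (Y i), e (Y j)\<rangle> = 0" and xy: "\<langle>e (X i), e (Y j)\<rangle> = (if i = j then 1 else 0)"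
    and xx': "\<langle>e (X i), e (X j)\<rangle> = 0" if "i \<in> {1..5}" "j \<in> {1..5}" for i j
    using gram that by (simp_all add: gram_def)
  have orth: "b \<noteq> X i \<Longrightarrow> \<langle>e (Y i), e b\<rangle> = 0" "b \<noteq> Y i \<Longrightarrow> \<langle>e (X i), e b\<rangle> = 0"
    if "i \<in> {1..5}" "b \<in> bsyms 5" for i b
    using that yX yy xy xx' by (cases b; auto)+
  \<comment> \<open>Stated for all symbols, so that it is invariant under permutations and only
    increasing triples need to be examined.\<close>
  define Q where "Q u v w \<longleftrightarrow> u \<in> bsyms 5 \<longrightarrow> v \<in> bsyms 5 \<longrightarrow> w \<in> bsyms 5 \<longrightarrow>
      (\<forall>((u', v', w'), c) \<in> set (P10_2_4 r). mset [u, v, w] \<noteq> mset [u', v', w']) \<longrightarrow>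
      tri (e u) (e v) (e w) = 0" for u v w
  have other: "Q u v w" for u v w
  proof (rule wlog_sorted_triple[of Q rank])
    show "Q v u w" if "Q u v w" for u v w
      using that tri_swap[of "e v" "e u" "e w"] by (auto simp: Q_def add_mset_commute)
    show "Q u w v" if "Q u v w" for u v w
      using that tri_swap'[of "e u" "e w" "e v"] by (auto simp: Q_def add_mset_commute)
    show "Q u u w" for u w
      by (simp add: Q_def)
    show "u = v" if "rank u = rank v" for u v
      using that by (auto simp: rank_def split: bsym.splits)
    show "Q u v w" if uv: "rank u < rank v" and vw: "rank v < rank w" for u v w
      unfolding Q_def
    proof (intro impI)
      assume b: "u \<in> bsyms 5" "v \<in> bsyms 5" "w \<in> bsyms 5"
        and n: "\<forall>((u', v', w'), c) \<in> set (P10_2_4 r). mset [u, v, w] \<noteq> mset [u', v', w']"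
      \<comment> \<open>The five listed triples, each sorted by \<open>rank\<close>.\<close>
      have n': "(u, v, w) \<notin> {(Y 5, Y 4, X 3), (Y 5, Y 3, X 2), (Y 5, Y 2, X 1), (Y 4, Y 3, X 1), (Y 4, Y 2, Y 1)}"
        using n by (auto simp: P10_2_4_def add_mset_commute)
      have small: "b \<in> {Y 5, Y 4, Y 3, Y 2} \<or> - 2 \<le> rank b \<and> e b \<in> lc 4" if "b \<in> bsyms 5" for b
        using that lc1 lc4 unfolding bsyms_5 by (elim insertE emptyE) (simp_all add: rank_def)
      show "tri (e u) (e v) (e w) = 0"
      proof (cases "v \<in> {Y 5, Y 4, Y 3, Y 2}")
        case False
        \<comment> \<open>Since \<open>w\<close> comes after \<open>v\<close>, both give vectors in
          L^4, where products are zero.\<close>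
        then have "- 2 \<le> rank v" "e v \<in> lc 4"
          using small[OF b(2)] by blast+
        moreover have "e w \<in> lc 4"
          using small[OF b(3)] vw calculation(1) by (auto simp: rank_def)
        ultimately show ?thesis by (intro t44)
      next
        case True
        then have "(u, v) \<in> {(Y 5, Y 4), (Y 5, Y 3), (Y 4, Y 3), (Y 5, Y 2), (Y 4, Y 2), (Y 3, Y 2)}"
          using small[OF b(1)] uv by (auto simp: rank_def)
        then consider "u = Y 5" "v = Y 4" | "u = Y 5" "v = Y 3" | "u = Y 4" "v = Y 3"
          | "u = Y 5" "v = Y 2" | "u = Y 4" "v = Y 2" | "u = Y 3" "v = Y 2" by blast
        then show ?thesis
        proof cases
          case 3
          then show ?thesis
            using b(3) vw n' y43 t34 lcX unfolding bsyms_5 by (elim insertE emptyE) (simp_all add: rank_def)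
        next
          case 6
          then have "e w \<in> lc 4"
            using small[OF b(3)] vw by (auto simp: rank_def)
          then show ?thesis using 6 t24 by simp
        qed (use b(3) n' in \<open>simp_all add: swapped orth\<close>)
      qed
    qed
  qed
  have listed: "\<forall>((u, v, w), c)\<in>set (P10_2_4 r). tri (e u) (e v) (e w) = c"
    using swapped(4)[of "e (Y 1)"] y34(1)
    by (simp add: P10_2_4_def tri_rot[of "e (X i)" for i] tri_rot[of "e (Y 1)"] T yX xy)
  show ?thesis
    unfolding presented_by_def form_mul_left using std listed other unfolding Q_def by blast
qed

end

context class7_saa
begin

declare One_nat_def [simp del]

lemma normal_pair_presented:
  assumes np: "normal_pair r u v"
  shows "presented_by L 5 (P10_2_4 r)"
proof -
  \<comment> \<open>With y_4 = u and y_5 = v, these vectors solve y_4 y_5 = - r y_3, y_3 y_5 = -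
    y_2, y_2 y_5 = - y_1 and y_2 y_4 = x_1; the other x_i are the products that
    \<open>presentedI\<close> asks for.\<close>
  define y3 where "y3 = - inverse r *\<^sub>L (u \<cdot> v)"
  define y2 where "y2 = - (y3 \<cdot> v)"
  define y1 where "y1 = - (y2 \<cdot> v)"
  define x1 where "x1 = y2 \<cdot> u"
  define e where "e b = (if b = Y 5 then v else if b = Y 4 then u else if b = Y 3 then y3
      else if b = Y 2 then y2 else if b = Y 1 then y1 else if b = X 1 then x1
      else if b = X 2 then - (x1 \<cdot> v) else if b = X 3 then - (x1 \<cdot> u)
      else if b = X 4 then y1 \<cdot> y2 else x1 \<cdot> y2)" for b
  have r: "r \<noteq> 0" and uv: "\<langle>u, v\<rangle> = 0" and f: "u \<cdot> v \<cdot> u \<in> lc 4"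
    and alpha: "\<langle>u \<cdot> v \<cdot> v \<cdot> u, u \<cdot> v \<cdot> v \<cdot> v\<rangle> = - r\<^sup>2" and kappa: "\<langle>u \<cdot> v \<cdot> u, u \<cdot> v \<cdot> v \<cdot> u\<rangle> = - r\<^sup>2"
    and theta: "\<langle>u \<cdot> v \<cdot> u, u \<cdot> v \<cdot> v\<rangle> = 0" and eta: "\<langle>u \<cdot> v \<cdot> u, u \<cdot> v \<cdot> v \<cdot> v\<rangle> = 0"
    using np by (auto simp: normal_pair_def)
  have y3u: "y3 \<cdot> u = - inverse r *\<^sub>L (u \<cdot> v \<cdot> u)"
    and y2': "y2 = inverse r *\<^sub>L (u \<cdot> v \<cdot> v)" and x1': "x1 = inverse r *\<^sub>L (u \<cdot> v \<cdot> v \<cdot> u)"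
    and y1': "y1 = - inverse r *\<^sub>L (u \<cdot> v \<cdot> v \<cdot> v)"
    by (simp_all add: y3_def y2_def y1_def x1_def)
  show ?thesis
  proof (rule presentedI[of r e, OF r])
    show "e (Y 4) \<cdot> e (Y 5) = - r *\<^sub>L e (Y 3)"
      using r by (simp add: e_def y3_def)
    show "\<langle>e (X 1), e (Y 1)\<rangle> = 1"
      using r alpha by (simp add: e_def x1' y1' power2_eq_square field_simps)
    show "tri (e (Y 3)) (e (Y 4)) (e (X 1)) = 1"
      using r kappa by (simp add: e_def tri_def x1' y3u power2_eq_square field_simps)
    show "tri (e (Y 3)) (e (Y 4)) (e (Y 1)) = 0" "tri (e (Y 3)) (e (Y 4)) (e (Y 2)) = 0"
      using theta eta by (simp_all add: e_def tri_def y1' y2' y3u)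
    show "e (Y 3) \<cdot> e (Y 4) \<in> lc 4"
      using lc_scale[OF f, of "- inverse r"] by (simp add: e_def y3u)
  qed (simp_all add: e_def y2_def y1_def x1_def uv)
qed

text \<open>The parameters \<open>c\<close> and \<open>d\<close> kill \<open>\<langle>pu, pvv\<rangle>\<close> and \<open>\<langle>pu, pv\<rangle>\<close> for \<open>p = uv\<close>;
  adding a central vector to \<open>u\<close> then changes no product, only \<open>\<langle>u, v\<rangle>\<close>.\<close>

lemma normal_pairI:
  assumes f: "u \<cdot> v \<cdot> u \<in> lc 4"
    and alpha: "\<langle>u \<cdot> v \<cdot> v \<cdot> u, u \<cdot> v \<cdot> v \<cdot> v\<rangle> \<noteq> 0" and kappa: "\<langle>u \<cdot> v \<cdot> u, u \<cdot> v \<cdot> v \<cdot> u\<rangle> \<noteq> 0"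
  shows "\<exists>r u v. normal_pair r u v"
proof -
  define p q n m f where "p = u \<cdot> v" and "q = p \<cdot> v" and "n = q \<cdot> u" and "m = q \<cdot> v" and "f = p \<cdot> u"
  define \<alpha> \<kappa> where "\<alpha> = \<langle>n, m\<rangle>" and "\<kappa> = \<langle>f, n\<rangle>"
  define c d where "c = - \<langle>f, m\<rangle> / \<kappa>" and "d = \<langle>f, q\<rangle> / \<kappa>"
  note defs = p_def q_def n_def m_def f_def
  have nz: "\<alpha> \<noteq> 0" "\<kappa> \<noteq> 0"
    using alpha kappa by (simp_all add: \<alpha>_def \<kappa>_def defs)
  have p: "p \<in> lc 2" and q: "q \<in> lc 3" and n: "n \<in> lc 4" and m: "m \<in> lc 4" and f: "f \<in> lc 4"
    using f by (auto simp: defs intro!: mul_in_lc_numeral)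
  define v' where "v' = v + c *\<^sub>L u + d *\<^sub>L p"
  define l where "l = - d *\<^sub>L (f \<cdot> v') "
  have p': "u \<cdot> v' = p - d *\<^sub>L f"
    using mul_anticomm[of u p] by (simp add: v'_def defs)
  have l: "l \<in> lc 5"
    unfolding l_def by (intro lc_scale mul_in_lc_numeral f)
  have q': "u \<cdot> v' \<cdot> v' = q + c *\<^sub>L f + l"
  proof -
    have "p \<cdot> v' = q + c *\<^sub>L f" by (simp add: v'_def defs)
    then show ?thesis by (simp add: p' l_def)
  qed
  have f': "u \<cdot> v' \<cdot> u = f - d *\<^sub>L (f \<cdot> u)"
    by (simp add: p' f_def)
  define k where "k = (c *\<^sub>L f + l) \<cdot> v'"
  have k: "k \<in> lc 5" "(c *\<^sub>L f + l) \<cdot> u \<in> lc 5"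
    unfolding k_def using f l lc_antimono[of 4 5] by (auto intro!: mul_in_lc_numeral)
  have n': "u \<cdot> v' \<cdot> v' \<cdot> u = n + (c *\<^sub>L f + l) \<cdot> u"
    by (simp add: q' n_def add.assoc)
  have m': "u \<cdot> v' \<cdot> v' \<cdot> v' = m + c *\<^sub>L n + d *\<^sub>L (q \<cdot> p) + k"
  proof -
    have "q \<cdot> v' = m + c *\<^sub>L n + d *\<^sub>L (q \<cdot> p)" by (simp add: v'_def n_def m_def)
    then show ?thesis by (simp add: q' k_def add.assoc)
  qed
  have perp: "\<langle>a, b\<rangle> = 0" "\<langle>b, a\<rangle> = 0" if "a \<in> lc 4" "b \<in> lc 5" for a b
    using that by (auto intro: lc_perp[of _ 4 _ 5] lc_perp[of _ 5 _ 4])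
  have perp5: "\<langle>a, b\<rangle> = 0" if "a \<in> lc 5" "b \<in> lc 5" for a b
    using that by (auto intro: lc_perp[of _ 5 _ 5])
  \<comment> \<open>The term d qp, which the change of v adds to m, is not seen by the form on
    L^4.\<close>
  have qp: "\<langle>a, q \<cdot> p\<rangle> = 0" if "a \<in> lc 4" for a
    using tri_4_3_2[OF that q p] tri_rot[of a q p] by (simp add: form_mul_right)
  have fu: "f \<cdot> u \<in> lc 5" by (intro mul_in_lc_numeral f)
  have mm: "m + c *\<^sub>L n + d *\<^sub>L (q \<cdot> p) \<in> lc 4"
    using m n q by (auto intro!: mul_in_lc_numeral)
  \<comment> \<open>This explains the choice of d: passing from f to f - d fu lowers the pairing
    with q by d \<kappa>.\<close>
  have fuq: "\<langle>f \<cdot> u, q\<rangle> = \<kappa>"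
    using tri_rot[of f u q] tri_swap[of u q f] form_anticomm[of f n] by (simp add: \<kappa>_def n_def tri_def)
  have alpha': "\<langle>u \<cdot> v' \<cdot> v' \<cdot> u, u \<cdot> v' \<cdot> v' \<cdot> v'\<rangle> = \<alpha>"
    using perp(2)[OF mm k(2)] perp(1)[OF n k(1)] perp5[OF k(2,1)] by (simp add: n' m' \<alpha>_def qp n add.assoc)
  have kappa': "\<langle>u \<cdot> v' \<cdot> u, u \<cdot> v' \<cdot> v' \<cdot> u\<rangle> = \<kappa>"
    using perp(1)[OF f k(2)] perp5[OF fu k(2)] perp(2)[OF n fu] by (simp add: n' f' \<kappa>_def algebra_simps)
  have theta': "\<langle>u \<cdot> v' \<cdot> u, u \<cdot> v' \<cdot> v'\<rangle> = 0"
    using perp(1)[OF f l] perp5[OF fu l] perp(2)[OF f fu] nz by (simp add: q' f' fuq d_def)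
  have eta': "\<langle>u \<cdot> v' \<cdot> u, u \<cdot> v' \<cdot> v' \<cdot> v'\<rangle> = 0"
    using perp(1)[OF f k(1)] perp5[OF fu k(1)] perp(2)[OF m fu] perp(2)[OF n fu] qp[OF f]
      perp(2)[OF mul_in_lc_numeral(3)[OF q] fu] nz
    by (simp add: m' f' c_def add.assoc flip: \<kappa>_def)
  \<comment> \<open>A central vector that is not orthogonal to \<open>v'\<close>, because \<alpha>
    is nonzero.\<close>
  define z where "z = n \<cdot> q"
  have z: "z \<in> lc 7"
    using mul_in_subprod[OF n q] lc_4_3 by (simp add: z_def)
  have central: "z \<cdot> w = 0" "w \<cdot> z = 0" for w
    using mul_in_lc_numeral(7)[OF z] mul_anticomm[of w z] by simp_all
  have zv: "\<langle>z, v'\<rangle> = - \<alpha>"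
  proof -
    have "\<langle>z, v\<rangle> = - \<alpha>"
      using tri_rot[of n q v] form_anticomm[of n m] by (simp add: z_def \<alpha>_def m_def tri_def)
    moreover have "\<langle>z, u\<rangle> = 0"
      using tri_rot[of n q u] by (simp add: z_def tri_def flip: n_def)
    moreover have "\<langle>z, p\<rangle> = 0"
      using lc_perp[OF z p] by simp
    ultimately show ?thesis by (simp add: v'_def)
  qed
  define u' where "u' = u + (\<langle>u, v'\<rangle> / \<alpha>) *\<^sub>L z"
  have uv': "\<langle>u', v'\<rangle> = 0"
    using nz by (simp add: u'_def zv)
  have u': "u' \<cdot> w = u \<cdot> w" "w \<cdot> u' = w \<cdot> u" for w
    by (simp_all add: u'_def central)
  have f'': "u \<cdot> v' \<cdot> u \<in> lc 4"
    unfolding f' using f fu lc_antimono[of 4 5] by auto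
  \<comment> \<open>The factors a = \<kappa> \<alpha> and b = - \<kappa> satisfy \<alpha> a^3 b^5 =
    \<kappa> a^4 b^3, and both sides are minus the square of \<alpha>^2 \<kappa>^4.\<close>
  have "normal_pair (\<alpha>\<^sup>2 * \<kappa> ^ 4) ((\<kappa> * \<alpha>) *\<^sub>L u') (- \<kappa> *\<^sub>L v')"
    unfolding normal_pair_def using nz uv' lc_neg[OF lc_scale[OF f'']]
    by (simp add: u' alpha' kappa' theta' eta' power_numeral_reduce algebra_simps)
  then show ?thesis by blast
qed

end

section \<open>Dimensions and generators forced by the stated properties\<close>

locale stated_saa = saa L for L :: "('a::field, 'v::ab_group_add) sympl_struct" +
  assumes stated: "has_stated_properties L"
begin

lemma dim_UNIV_10: "dim UNIV = 10" and dim_center: "dim (saa_center L) = 2"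
  and lc_4_3_eq: "subprod L (lc 4) (lc 3) = lc 7"
  and dim_U_2: "dim (subprod L (char_U L) (lc 2)) = 2"
  using stated by (auto simp: has_stated_properties_def simp del: dim_UNIV)

lemma lc_8_0: "lc 8 = {0}" and lc_7_nonzero: "lc 7 \<noteq> {0}"
proof -
  have nc: "(LEAST k. lc (Suc k) = {0}) = 7" "\<exists>k. lc (Suc k) = {0}"
    using stated by (auto simp: has_stated_properties_def nil_class_def saa_nilpotent_def)
  show "lc 8 = {0}"
    using LeastI_ex[OF nc(2)] unfolding nc(1) by simp
  show "lc 7 \<noteq> {0}"
    using not_less_Least[of 6 "\<lambda>k. lc (Suc k) = {0}"] unfolding nc(1) by simp
qed

end

sublocale stated_saa \<subseteq> class7_saa
  using dim_UNIV_10 lc_8_0 lc_4_3_eq by unfold_locales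

context stated_saa
begin

declare One_nat_def [simp del]

text \<open>Once two consecutive terms agree the series is constant, but L^7 is nonzero and L^8 is
  zero.\<close>

lemma lc_strict:
  assumes "k \<noteq> 0" "k \<le> 7"
  shows "lc (Suc k) \<noteq> lc k"
proof
  assume eq: "lc (Suc k) = lc k"
  have "lc (k + j) = lc k" for j
  proof (induction j)
    case (Suc j)
    then have "lc (Suc (k + j)) = lc (Suc k)"
      using assms by (simp add: lc_Suc)
    then show ?case using eq by simp
  qed simp
  from this[of "7 - k"] this[of "8 - k"] have "lc 7 = lc 8"
    using assms by simp
  then show False
    using lc_8_0 lc_7_nonzero by simp
qed

lemma dim_lc_less: "k \<noteq> 0 \<Longrightarrow> k \<le> 7 \<Longrightarrow> dim (lc (Suc k)) < dim (lc k)"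
  using lc_strict[of k] lc_Suc_subset[of k] subspace_dim_equal[of "lc (Suc k)" "lc k"]
    dim_subset[OF lc_Suc_subset, of k] by (metis lc_subspace le_neq_implies_less linorder_le_cases)

lemma subspace_center: "subspace (saa_center L)"
  by (auto simp: saa_center_def subspace_def)

lemma lc_2_perp_center:
  assumes "x \<in> lc 2" "z \<in> saa_center L" shows "\<langle>x, z\<rangle> = 0"
proof -
  have "x \<in> lc (Suc 1)" using assms by simp
  moreover have "tri a b z = 0" for a b
    using assms(2) tri_rot[of z a b] by (simp add: tri_def saa_center_def)
  ultimately show ?thesis by (intro lc_perp_Suc[of 1]) auto
qed

text \<open>Take x in L^6 with (xa, b) nonzero. Then xb is nonzero since (xb, a) = - (xa, b), and xa
  is not a multiple of xb since (xb, b) = 0.\<close>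

lemma dim_lc_7: "2 \<le> dim (lc 7)"
proof -
  have "\<exists>x\<in>lc 6. \<exists>a. x \<cdot> a \<noteq> 0"
  proof (rule ccontr)
    assume "\<not> ?thesis"
    then have "subprod L (lc 6) UNIV \<subseteq> {0}"
      by (intro subprod_subset) auto
    then have "lc (Suc 6) \<subseteq> {0}" by (subst lc_Suc) auto
    then show False using lc_7_nonzero by auto
  qed
  then obtain x a where x: "x \<in> lc 6" "x \<cdot> a \<noteq> 0" by blast
  then obtain b where b: "tri x a b \<noteq> 0"
    using form_nondegenerate[of "x \<cdot> a"] by (auto simp: tri_def)
  have mem: "x \<cdot> a \<in> lc 7" "x \<cdot> b \<in> lc 7"
    using x mul_in_lc_numeral by auto
  have "x \<cdot> b \<noteq> 0"
    using b tri_swap'[of x a b] by (auto simp: tri_def)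
  moreover have "x \<cdot> a \<notin> span {x \<cdot> b}"
  proof
    assume "x \<cdot> a \<in> span {x \<cdot> b}"
    then obtain k where "x \<cdot> a = k *\<^sub>L (x \<cdot> b)"
      by (auto simp: span_singleton)
    then have "tri x a b = k * \<langle>x \<cdot> b, b\<rangle>" by (simp add: tri_def)
    then show False using b by (simp add: form_mul_left)
  qed
  ultimately have "dim {x \<cdot> a, x \<cdot> b} = 2"
    by (simp add: dim_insert)
  then show ?thesis
    using dim_subset[of "{x \<cdot> a, x \<cdot> b}" "lc 7"] mem by simp
qed

lemma lc_7_eq_center: "lc 7 = saa_center L"
  using mul_in_lc_numeral(7) dim_lc_7 dim_center
  by (intro subspace_dim_equal subspace_center) (auto simp: saa_center_def)

text \<open>Together with \<open>lc_2_perp_center\<close> this identifies the center with the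
  orthogonal complement of L^2; the reason is (xy, z) = (yz, x).\<close>

lemma center_if_perp_lc_2:
  assumes "\<And>h. h \<in> lc 2 \<Longrightarrow> \<langle>x, h\<rangle> = 0"
  shows "x \<in> saa_center L"
proof -
  have "x \<cdot> y = 0" for y
  proof (rule eq_if_forms_eq)
    fix z
    have "\<langle>x, y \<cdot> z\<rangle> = 0" by (intro assms mul_in_lc_numeral)
    then show "\<langle>x \<cdot> y, z\<rangle> = \<langle>0, z\<rangle>"
      using tri_rot[of x y z] by (simp add: form_mul_left form_mul_right)
  qed
  then show ?thesis by (simp add: saa_center_def)
qed

text \<open>Otherwise (xy, z) = (yz, x) = 0 for x in L^4 and y in L^3, and L^7 = L^4 L^3 would be
  zero.\<close>

lemma lc_4_not_isotropic: "\<exists>a\<in>lc 4. \<exists>b\<in>lc 4. \<langle>a, b\<rangle> \<noteq> 0"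
proof (rule ccontr)
  assume iso: "\<not> ?thesis"
  have "x \<cdot> y = 0" if "x \<in> lc 4" "y \<in> lc 3" for x y
  proof (rule eq_if_forms_eq)
    fix z
    have "y \<cdot> z \<in> lc 4" using that mul_in_lc_numeral by simp
    then have "\<langle>y \<cdot> z, x\<rangle> = 0" using iso that by blast
    then show "\<langle>x \<cdot> y, z\<rangle> = \<langle>0, z\<rangle>"
      using tri_rot[of x y z] by (simp add: tri_def)
  qed
  then have "subprod L (lc 4) (lc 3) \<subseteq> {0}"
    by (intro subprod_subset) auto
  then show False
    using lc_4_3_eq lc_7_nonzero by auto
qed

text \<open>The test vectors \<open>a'\<close> and \<open>b'\<close> annihilate W and pair with
  \<open>a\<close> and \<open>b\<close> in a triangular way, so \<open>a\<close> and
  \<open>b\<close> are independent modulo W.\<close>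

lemma dim_insert_insert:
  assumes "subspace W" "\<And>w. w \<in> W \<Longrightarrow> \<langle>w, a'\<rangle> = 0" "\<And>w. w \<in> W \<Longrightarrow> \<langle>w, b'\<rangle> = 0"
    and "\<langle>a, a'\<rangle> \<noteq> 0" "\<langle>a, b'\<rangle> = 0" "\<langle>b, b'\<rangle> \<noteq> 0"
  shows "dim (insert b (insert a W)) = dim W + 2"
proof -
  have W: "span W = W" using assms(1) by simp
  have "a \<notin> span W" unfolding W using assms by blast
  moreover have "b \<notin> span (insert a W)"
  proof
    assume "b \<in> span (insert a W)"
    then obtain k where "b - k *\<^sub>L a \<in> W"
      using span_breakdown_eq[of b a W] W by auto
    then have "\<langle>b - k *\<^sub>L a, b'\<rangle> = 0" by (rule assms(3))
    then show False using assms by simp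
  qed
  ultimately show ?thesis by (simp add: dim_insert)
qed

text \<open>A squeeze. From L^7 upwards the dimension starts with at least 2 and grows in every
  step, by at least 2 from L^5 to L^4 because L^4 is not isotropic but orthogonal to L^5. So L^2 has
  dimension at least 8, and at most 8 because it is orthogonal to the center.\<close>

lemma dim_lc: "dim (lc 3) = 7" "dim (lc 4) = 6" "dim (lc 2) = 8"
  and generators: "\<exists>u v. span (insert v (insert u (lc 2))) = UNIV"
proof -
  have "dim (lc 7) < dim (lc 6)" "dim (lc 6) < dim (lc 5)"
    using dim_lc_less[of 6] dim_lc_less[of 5] by simp_all
  then have 5: "4 \<le> dim (lc 5)" using dim_lc_7 by linarith
  obtain a b where ab: "a \<in> lc 4" "b \<in> lc 4" "\<langle>a, b\<rangle> \<noteq> 0"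
    using lc_4_not_isotropic by blast
  have p: "\<langle>w, c\<rangle> = 0" if "w \<in> lc 5" "c \<in> lc 4" for w c
    using that by (rule lc_perp) auto
  have "dim (insert b (insert a (lc 5))) = dim (lc 5) + 2"
    using ab form_anticomm[of b a] p by (intro dim_insert_insert[of _ b a]) auto
  moreover have "insert b (insert a (lc 5)) \<subseteq> lc 4"
    using ab lc_antimono[of 4 5] by auto
  ultimately have 4: "6 \<le> dim (lc 4)"
    using dim_subset[of "insert b (insert a (lc 5))" "lc 4"] 5 by linarith
  have 3: "dim (lc 4) < dim (lc 3)" and 2: "dim (lc 3) < dim (lc 2)"
    using dim_lc_less[of 3] dim_lc_less[of 2] by simp_all
  obtain z1 z2 where z: "z1 \<in> saa_center L" "z2 \<in> saa_center L" "z2 \<noteq> 0" "\<And>k. z1 \<noteq> k *\<^sub>L z2"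
  proof -
    obtain B where B: "B \<subseteq> saa_center L" "independent B" "card B = 2"
      using basis_exists[of "saa_center L"] dim_center by metis
    then obtain z1 z2 where "B = {z1, z2}" "z1 \<noteq> z2" by (auto simp: card_2_iff)
    moreover from this have "z1 \<notin> span {z2}" "z2 \<noteq> 0"
      using B(2) by (auto simp: independent_insert)
    ultimately show thesis
      using B(1) by (intro that[of z1 z2]) (auto simp: span_singleton)
  qed
  \<comment> \<open>The vectors w and u pair in a triangular way with the basis z1, z2 of the
    center; they will span a complement of L^2.\<close>
  obtain w where w: "\<langle>w, z2\<rangle> = 1"
  proof -
    obtain y where "\<langle>z2, y\<rangle> \<noteq> 0"
      using form_nondegenerate z(3) by blast
    then have "\<langle>(1 / \<langle>y, z2\<rangle>) *\<^sub>L y, z2\<rangle> = 1"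
      using form_anticomm[of z2 y] by simp
    then show thesis by (rule that)
  qed
  obtain u where u: "\<langle>u, z1\<rangle> \<noteq> 0" "\<langle>u, z2\<rangle> = 0"
  proof (rule ccontr)
    assume n: "\<not> thesis"
    have "z1 = \<langle>w, z1\<rangle> *\<^sub>L z2"
    proof (rule eq_if_forms_eq)
      fix y
      have "\<langle>y - \<langle>y, z2\<rangle> *\<^sub>L w, z2\<rangle> = 0" using w by simp
      then have "\<langle>y - \<langle>y, z2\<rangle> *\<^sub>L w, z1\<rangle> = 0" using n that by blast
      then have "\<langle>y, z1\<rangle> = \<langle>y, \<langle>w, z1\<rangle> *\<^sub>L z2\<rangle>" by simp
      then show "\<langle>z1, y\<rangle> = \<langle>\<langle>w, z1\<rangle> *\<^sub>L z2, y\<rangle>"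
        using form_anticomm[of z1 y] form_anticomm[of z2 y] by simp
    qed
    then show False using z(4) by blast
  qed
  have d: "dim (insert w (insert u (lc 2))) = dim (lc 2) + 2"
    using u w z lc_2_perp_center by (intro dim_insert_insert[of _ z1 z2]) auto
  then have "dim (lc 2) \<le> 8"
    using dim_subset[of "insert w (insert u (lc 2))" UNIV] dim_UNIV_10 by simp
  then show "dim (lc 3) = 7" "dim (lc 4) = 6" and d2: "dim (lc 2) = 8"
    using 2 3 4 by linarith+
  have "dim UNIV \<le> dim (span (insert w (insert u (lc 2))))"
    using d d2 dim_UNIV_10 by simp
  then have "span (insert w (insert u (lc 2))) = UNIV"
    by (intro subspace_dim_equal) auto
  then show "\<exists>u v. span (insert v (insert u (lc 2))) = UNIV" by blast
qed

text \<open>As L^3/L^4 is one-dimensional, some combination of (uv)u and (uv)v lies in L^4. Either u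
  and v are exchanged or u is replaced by u - kv, which leaves uv unchanged.\<close>

lemma good_generators:
  obtains u v where "\<And>x. \<exists>a b. x - a *\<^sub>L u - b *\<^sub>L v \<in> lc 2" "u \<cdot> v \<cdot> u \<in> lc 4"
proof -
  obtain u v where "span (insert v (insert u (lc 2))) = UNIV"
    using generators by blast
  then have gen: "\<exists>a b. x - a *\<^sub>L u - b *\<^sub>L v \<in> lc 2" for x
  proof -
    have "x \<in> span (insert v (insert u (lc 2)))" using \<open>span _ = UNIV\<close> by simp
    then obtain b where "x - b *\<^sub>L v \<in> span (insert u (lc 2))"
      unfolding span_breakdown_eq[of x] by blast
    then obtain a where "x - b *\<^sub>L v - a *\<^sub>L u \<in> span (lc 2)"
      unfolding span_breakdown_eq[of "x - b *\<^sub>L v"] by blast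
    then have "x - a *\<^sub>L u - b *\<^sub>L v \<in> lc 2"
      by (simp add: span_eq_iff[THEN iffD2] diff_diff_eq add.commute)
    then show ?thesis by blast
  qed
  show thesis
  proof (cases "u \<cdot> v \<cdot> v \<in> lc 4")
    case True
    have "\<exists>a b. x - a *\<^sub>L v - b *\<^sub>L u \<in> lc 2" for x
    proof -
      obtain a b where "x - a *\<^sub>L u - b *\<^sub>L v \<in> lc 2" using gen by blast
      then have "x - b *\<^sub>L v - a *\<^sub>L u \<in> lc 2" by (simp add: diff_diff_eq add.commute)
      then show ?thesis by blast
    qed
    moreover have "v \<cdot> u \<cdot> v \<in> lc 4"
      using True mul_anticomm[of v u] by auto
    ultimately show ?thesis by (rule that)
  next
    case False
    have mem: "u \<cdot> v \<cdot> w \<in> lc 3" for w by (intro mul_in_lc_numeral)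
    have "span (insert (u \<cdot> v \<cdot> v) (lc 4)) = lc 3"
    proof (rule subspace_dim_equal)
      have "insert (u \<cdot> v \<cdot> v) (lc 4) \<subseteq> lc 3"
        using mem lc_antimono[of 3 4] by auto
      then show "span (insert (u \<cdot> v \<cdot> v) (lc 4)) \<subseteq> lc 3"
        by (rule span_minimal) simp
      have "u \<cdot> v \<cdot> v \<notin> span (lc 4)" using False unfolding span_eq_iff[THEN iffD2, OF lc_subspace] .
      then show "dim (lc 3) \<le> dim (span (insert (u \<cdot> v \<cdot> v) (lc 4)))"
        using dim_lc by (simp add: dim_insert)
    qed auto
    then have "u \<cdot> v \<cdot> u \<in> span (insert (u \<cdot> v \<cdot> v) (lc 4))"
      using mem by simp
    then obtain k where k: "u \<cdot> v \<cdot> u - k *\<^sub>L (u \<cdot> v \<cdot> v) \<in> lc 4"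
      unfolding span_breakdown_eq span_eq_iff[THEN iffD2, OF lc_subspace] by blast
    show ?thesis
    proof (rule that[of "u - k *\<^sub>L v" v])
      show "(u - k *\<^sub>L v) \<cdot> v \<cdot> (u - k *\<^sub>L v) \<in> lc 4"
        using k by simp
      fix x
      obtain a b where "x - a *\<^sub>L u - b *\<^sub>L v \<in> lc 2" using gen by blast
      then have "x - a *\<^sub>L (u - k *\<^sub>L v) - (b + a * k) *\<^sub>L v \<in> lc 2"
        by (simp add: algebra_simps)
      then show "\<exists>a b. x - a *\<^sub>L (u - k *\<^sub>L v) - b *\<^sub>L v \<in> lc 2" by blast
    qed
  qed
qed

end

section \<open>Existence of a normal pair\<close>

context stated_saa
begin

declare One_nat_def [simp del]

lemma ex_normal_pair: "\<exists>r u v. normal_pair r u v"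
proof -
  obtain u v where gen: "\<And>x. \<exists>a b. x - a *\<^sub>L u - b *\<^sub>L v \<in> lc 2" and f: "u \<cdot> v \<cdot> u \<in> lc 4"
    using good_generators by blast
  define p q n m where "p = u \<cdot> v" and "q = p \<cdot> v" and "n = q \<cdot> u" and "m = q \<cdot> v"
  have p: "p \<in> lc 2" and q: "q \<in> lc 3" and n: "n \<in> lc 4" and m: "m \<in> lc 4" and f: "p \<cdot> u \<in> lc 4"
    using f by (auto simp: p_def q_def n_def m_def intro!: mul_in_lc_numeral)
  \<comment> \<open>L^2 is spanned by p modulo L^3, as u and v span the algebra modulo L^2.\<close>
  have span2: "lc 2 \<subseteq> {x. \<exists>a. x - a *\<^sub>L p \<in> lc 3}" (is "_ \<subseteq> ?W")
  proof -
    have "?W = span (insert p (lc 3))"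
      by (simp add: set_eq_iff span_breakdown_eq span_eq_iff[THEN iffD2])
    then have W: "subspace ?W" by simp
    have "x \<cdot> y \<in> ?W" for x y
    proof -
      obtain a b a' b' where x: "x - a *\<^sub>L u - b *\<^sub>L v \<in> lc 2" and y: "y - a' *\<^sub>L u - b' *\<^sub>L v \<in> lc 2"
        using gen by metis
      define h h' where "h = x - a *\<^sub>L u - b *\<^sub>L v" and "h' = y - a' *\<^sub>L u - b' *\<^sub>L v"
      have "x = a *\<^sub>L u + b *\<^sub>L v + h" "y = a' *\<^sub>L u + b' *\<^sub>L v + h'"
        by (simp_all add: h_def h'_def)
      then have "x \<cdot> y - (a * b' - b * a') *\<^sub>L p = h \<cdot> y + (a *\<^sub>L u + b *\<^sub>L v) \<cdot> h'"
        using mul_anticomm[of v u] by (simp add: p_def algebra_simps)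
      also have "\<dots> \<in> lc 3"
        using mul_in_lc[of h 2 y] mul_in_lc'[of h' 2 u] mul_in_lc'[of h' 2 v] x y
        by (auto simp flip: h_def h'_def intro!: lc_add lc_scale)
      finally show ?thesis by blast
    qed
    then have "subprod L (lc 1) UNIV \<subseteq> ?W" by (intro subprod_subset W)
    then show ?thesis using lc_Suc[of 1] by simp
  qed
  \<comment> \<open>L^3 is spanned by q modulo L^4, because pu lies in L^4.\<close>
  have span3: "lc 3 \<subseteq> {x. \<exists>a. x - a *\<^sub>L q \<in> lc 4}" (is "_ \<subseteq> ?W")
  proof -
    have "?W = span (insert q (lc 4))"
      by (simp add: set_eq_iff span_breakdown_eq span_eq_iff[THEN iffD2])
    then have W: "subspace ?W" by simp
    have "x \<cdot> y \<in> ?W" if x: "x \<in> lc 2" for x y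
    proof -
      obtain c where c: "x - c *\<^sub>L p \<in> lc 3" using span2 x by blast
      obtain a b where y: "y - a *\<^sub>L u - b *\<^sub>L v \<in> lc 2"
        using gen by metis
      define h h' where "h = x - c *\<^sub>L p" and "h' = y - a *\<^sub>L u - b *\<^sub>L v"
      obtain d where d: "h' - d *\<^sub>L p \<in> lc 3" using span2 y h'_def by blast
      define g where "g = h' - d *\<^sub>L p"
      have "x = c *\<^sub>L p + h" "y = a *\<^sub>L u + b *\<^sub>L v + (d *\<^sub>L p + g)"
        by (simp_all add: h_def h'_def g_def)
      then have "x \<cdot> y - (c * b) *\<^sub>L q = (c * a) *\<^sub>L (p \<cdot> u) + c *\<^sub>L (p \<cdot> g) + h \<cdot> y"
        by (simp add: q_def algebra_simps)
      also have "\<dots> \<in> lc 4"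
        using c d f mul_in_lc[of h 3 y] mul_in_lc'[of g 3 p]
        by (auto simp flip: h_def g_def intro!: lc_add lc_scale)
      finally show ?thesis by blast
    qed
    then have "subprod L (lc 2) UNIV \<subseteq> ?W" by (intro subprod_subset W)
    then show ?thesis using lc_Suc[of 2] by simp
  qed
  \<comment> \<open>L^4 is spanned by n and m modulo vectors orthogonal to L^4; among these are L^5
    and the products of q with L^2.\<close>
  have span4: "lc 4 \<subseteq> {x. \<exists>a b. \<forall>z\<in>lc 4. \<langle>x - a *\<^sub>L n - b *\<^sub>L m, z\<rangle> = 0}" (is "_ \<subseteq> ?W")
  proof -
    have "?W = span (insert n (insert m {x. \<forall>z\<in>lc 4. \<langle>x, z\<rangle> = 0}))"
      unfolding set_eq_iff span_breakdown_eq span_eq_iff[THEN iffD2, OF subspace_perp] by simp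
    then have W: "subspace ?W" by (simp only: subspace_span)
    have "x \<cdot> y \<in> ?W" if x: "x \<in> lc 3" for x y
    proof -
      obtain c where c: "x - c *\<^sub>L q \<in> lc 4" using span3 x by blast
      obtain a b where y: "y - a *\<^sub>L u - b *\<^sub>L v \<in> lc 2"
        using gen by metis
      define h h' where "h = x - c *\<^sub>L q" and "h' = y - a *\<^sub>L u - b *\<^sub>L v"
      have "x = c *\<^sub>L q + h" "y = a *\<^sub>L u + b *\<^sub>L v + h'"
        by (simp_all add: h_def h'_def)
      then have *: "x \<cdot> y - (c * a) *\<^sub>L n - (c * b) *\<^sub>L m = c *\<^sub>L (q \<cdot> h') + h \<cdot> y"
        by (simp add: n_def m_def algebra_simps)
      have "\<langle>c *\<^sub>L (q \<cdot> h') + h \<cdot> y, z\<rangle> = 0" if z: "z \<in> lc 4" for z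
      proof -
        have "tri q h' z = 0"
          using tri_4_3_2[OF z q, of h'] y tri_rot[of z q h'] by (simp add: h'_def)
        moreover have "\<langle>h \<cdot> y, z\<rangle> = 0"
          using c z by (intro lc_perp[of _ 5 _ 4] mul_in_lc_numeral) (auto simp: h_def)
        ultimately show ?thesis by (simp add: form_mul_left)
      qed
      then show ?thesis unfolding *[symmetric] by blast
    qed
    then have "subprod L (lc 3) UNIV \<subseteq> ?W" by (intro subprod_subset W)
    then show ?thesis using lc_Suc[of 3] by simp
  qed
  have alpha: "\<langle>n, m\<rangle> \<noteq> 0"
  proof
    assume 0: "\<langle>n, m\<rangle> = 0"
    have "\<langle>x, y\<rangle> = 0" if x: "x \<in> lc 4" and y: "y \<in> lc 4" for x y
    proof -
      obtain a b c d where x': "\<And>z. z \<in> lc 4 \<Longrightarrow> \<langle>x - a *\<^sub>L n - b *\<^sub>L m, z\<rangle> = 0"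
        and y': "\<And>z. z \<in> lc 4 \<Longrightarrow> \<langle>y - c *\<^sub>L n - d *\<^sub>L m, z\<rangle> = 0"
        using subsetD[OF span4 x] subsetD[OF span4 y] by blast
      have "\<langle>x, y\<rangle> = a * \<langle>n, y\<rangle> + b * \<langle>m, y\<rangle>"
        using x'[OF y] by (simp add: algebra_simps)
      also have "\<dots> = 0"
        using y'[OF n] y'[OF m] 0 form_anticomm[of n y] form_anticomm[of m y] form_anticomm[of m n]
        by simp
      finally show ?thesis .
    qed
    then show False using lc_4_not_isotropic by blast
  qed
  define k where "k = (LEAST k. k \<in> {1..3} \<and> char_I L k \<inter> subprod L (lc 4) (lc 3) \<noteq> {0})"
  have I1: "char_I L 1 = subprod L (lc 5) (lc 2)"
    by (simp add: char_I_def)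
  \<comment> \<open>For h and h' in L^2 the value (lh, h') reduces to a multiple of (lp, p) = 0,
    because L^5 L^3 = 0. So lh is orthogonal to L^2 and therefore central.\<close>
  have I1_7: "char_I L 1 \<subseteq> lc 7"
    unfolding I1
  proof (rule subprod_subset)
    fix l h assume l: "l \<in> lc 5" and h: "h \<in> lc 2"
    have lg: "l \<cdot> g = 0" if "g \<in> lc 3" for g
      using l that by (rule lc_mul_0) auto
    obtain a where a: "h - a *\<^sub>L p \<in> lc 3" using span2 h by blast
    have "\<langle>l \<cdot> h, h'\<rangle> = 0" if h': "h' \<in> lc 2" for h'
    proof -
      obtain b where b: "h' - b *\<^sub>L p \<in> lc 3" using span2 h' by blast
      have "tri l (h - a *\<^sub>L p) h' = 0" "tri l (h' - b *\<^sub>L p) p = 0"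
        using lg[OF a] lg[OF b] by (simp_all only: tri_def form_lin')
      then show ?thesis
        using tri_swap'[of l p h'] by (simp add: form_mul_left)
    qed
    then show "l \<cdot> h \<in> lc 7"
      unfolding lc_7_eq_center by (rule center_if_perp_lc_2)
  qed simp
  \<comment> \<open>If L^5 L^2 were zero, L^6 would be orthogonal to L^2, hence central, and L^7
    would be zero.\<close>
  have I1_nonzero: "char_I L 1 \<noteq> {0}"
  proof
    assume "char_I L 1 = {0}"
    then have 0: "l \<cdot> h = 0" if "l \<in> lc 5" "h \<in> lc 2" for l h
      using mul_in_subprod[OF that] I1 by simp
    have "x \<in> saa_center L" if "x \<in> lc 6" for x
    proof (rule center_if_perp_lc_2)
      fix h assume h: "h \<in> lc 2"
      have "x \<in> lc (Suc 5)" using that by simp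
      moreover have "tri l w h = 0" if "l \<in> lc 5" for l w
        using 0[OF that h] tri_swap'[of l w h] by (simp add: tri_def)
      ultimately show "\<langle>x, h\<rangle> = 0" by (intro lc_perp_Suc[of 5]) auto
    qed
    then have "subprod L (lc 6) UNIV \<subseteq> {0}"
      by (intro subprod_subset) (auto simp: saa_center_def)
    then have "lc 7 \<subseteq> {0}" using lc_Suc[of 6] by simp
    then show False using lc_7_nonzero by auto
  qed
  have "k = 1"
    unfolding k_def lc_4_3_eq using I1_7 I1_nonzero by (intro Least_equality) auto
  then have U: "char_U L = {x \<in> lc 4. \<forall>y\<in>lc 3. x \<cdot> y \<in> subprod L (lc 5) (lc 2)}"
    unfolding char_U_def k_def[symmetric] Let_def I1[symmetric] by simp
  \<comment> \<open>Here the choice of u matters: (lp, u) = (pu, l) vanishes because pu is in L^4,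
    which is orthogonal to L^5.\<close>
  have I1u: "\<langle>x, u\<rangle> = 0" if "x \<in> subprod L (lc 5) (lc 2)" for x
    using that
  proof (rule subprod_perp)
    fix l h assume l: "l \<in> lc 5" and h: "h \<in> lc 2"
    obtain a where a: "h - a *\<^sub>L p \<in> lc 3" using span2 h by blast
    then have "l \<cdot> (h - a *\<^sub>L p) = 0" using l by (intro lc_mul_0[of _ 5 _ 3]) auto
    then have "tri l h u = a * tri l p u" by (simp add: tri_def)
    also have "tri l p u = \<langle>p \<cdot> u, l\<rangle>" using tri_rot[of l p u] by (simp add: tri_def)
    also have "\<dots> = 0" using f l by (rule lc_perp) auto
    finally show "tri l h u = 0" by simp
  qed
  \<comment> \<open>Otherwise U L^2 is orthogonal to u and to L^2. Its vectors are then determined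
    by their pairing with v, so its dimension is at most 1.\<close>
  have kappa: "\<langle>p \<cdot> u, n\<rangle> \<noteq> 0"
  proof
    assume 0: "\<langle>p \<cdot> u, n\<rangle> = 0"
    have u: "\<langle>y, u\<rangle> = 0" if "y \<in> subprod L (char_U L) (lc 2)" for y
      using that
    proof (rule subprod_perp)
      fix x h assume x: "x \<in> char_U L" and h: "h \<in> lc 2"
      then have x4: "x \<in> lc 4" and xI: "\<And>y. y \<in> lc 3 \<Longrightarrow> \<langle>x \<cdot> y, u\<rangle> = 0"
        unfolding U using I1u by blast+
      obtain a b where ab: "\<And>z. z \<in> lc 4 \<Longrightarrow> \<langle>x - a *\<^sub>L n - b *\<^sub>L m, z\<rangle> = 0"
        using subsetD[OF span4 x4] by blast
      \<comment> \<open>Since xq is orthogonal to u, x is orthogonal to n, and its m-component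
        vanishes because \<alpha> is nonzero.\<close>
      have "\<langle>n, x\<rangle> = 0"
        using xI[OF q] tri_rot[of x q u] by (simp add: tri_def n_def)
      then have "b = 0"
        using ab[OF n] alpha form_anticomm[of n x] form_anticomm[of m n] by simp
      then have "\<langle>x, p \<cdot> u\<rangle> = 0"
        using ab[OF f] 0 form_anticomm[of n "p \<cdot> u"] by simp
      then have pu: "tri x p u = 0"
        using tri_rot[of x p u] form_anticomm[of x "p \<cdot> u"] by (simp add: tri_def)
      obtain c where "h - c *\<^sub>L p \<in> lc 3" using span2 h by blast
      from xI[OF this] show "tri x h u = 0" using pu by (simp add: tri_def)
    qed
    have h: "\<langle>y, z\<rangle> = 0" if y: "y \<in> subprod L (char_U L) (lc 2)" and z: "z \<in> lc 2" for y z
      using y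
    proof (rule subprod_perp)
      fix x h assume x: "x \<in> char_U L" and h: "h \<in> lc 2"
      then have x4: "x \<in> lc 4" unfolding U by blast
      obtain a b where ab: "h - a *\<^sub>L p \<in> lc 3" "z - b *\<^sub>L p \<in> lc 3"
        using span2 h z by blast
      have "tri x (h - a *\<^sub>L p) z = 0" "tri x (z - b *\<^sub>L p) p = 0"
        using tri_4_3_2[OF x4 ab(1) z] tri_4_3_2[OF x4 ab(2) p] by simp_all
      then show "tri x h z = 0"
        using tri_swap'[of x p z] by simp
    qed
    obtain B where B: "B \<subseteq> subprod L (char_U L) (lc 2)" "independent B" "card B = 2"
      using basis_exists[of "subprod L (char_U L) (lc 2)"] dim_U_2 by metis
    then obtain y z where yz: "B = {y, z}" "y \<noteq> z" by (auto simp: card_2_iff)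
    have ind: "y \<notin> span {z}" "z \<noteq> 0"
      using B(2) yz by (auto simp: independent_insert)
    have v: "\<exists>b. \<forall>y\<in>B. \<langle>y, w\<rangle> = b * \<langle>y, v\<rangle>" for w
    proof -
      obtain a b where ab: "w - a *\<^sub>L u - b *\<^sub>L v \<in> lc 2" using gen by blast
      then have "\<forall>y\<in>B. \<langle>y, w - a *\<^sub>L u - b *\<^sub>L v\<rangle> = 0" using h B(1) by blast
      moreover have "\<forall>y\<in>B. \<langle>y, u\<rangle> = 0" using u B(1) by blast
      ultimately show ?thesis by (intro exI[of _ b]) simp
    qed
    have "\<langle>z, v\<rangle> \<noteq> 0"
    proof
      assume "\<langle>z, v\<rangle> = 0"
      then have "\<langle>z, w\<rangle> = 0" for w using v[of w] yz(1) by auto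
      then show False using form_nondegenerate ind(2) by blast
    qed
    moreover have "\<langle>z, v\<rangle> *\<^sub>L y = \<langle>y, v\<rangle> *\<^sub>L z"
    proof (rule eq_if_forms_eq)
      fix w
      show "\<langle>\<langle>z, v\<rangle> *\<^sub>L y, w\<rangle> = \<langle>\<langle>y, v\<rangle> *\<^sub>L z, w\<rangle>"
        using v[of w] yz(1) by auto
    qed
    ultimately have "y = (\<langle>y, v\<rangle> / \<langle>z, v\<rangle>) *\<^sub>L z"
      using scale_left_imp_eq scale_scale by (metis divide_inverse mult.commute right_inverse scale_one)
    then show False using ind(1) span_singleton by auto
  qed
  show ?thesis
    using normal_pairI[of u v] f alpha kappa by (simp add: p_def q_def n_def m_def)
qed

end

section \<open>Isomorphisms, existence of the algebras and the classification\<close>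

lemma presented_by_iso:
  assumes "saa L" "saa M" and f: "saa_iso L M f" and "presented_by L n P"
  shows "presented_by M n P"
proof -
  interpret l: saa L by fact
  interpret m: saa M by fact
  interpret vp: vector_space_pair "scl L" "scl M" by unfold_locales
  have lin: "Vector_Spaces.linear (scl L) (scl M) f" and bij: "bij f"
    and mul: "f (mul L x y) = mul M (f x) (f y)" and form: "form M (f x) (f y) = form L x y" for x y
    using f by (auto simp: saa_iso_def)
  obtain e where e: "standard_basis L n e"
    and P: "\<forall>((u, v, w), c) \<in> set P. form L (mul L (e u) (e v)) (e w) = c"
      "\<forall>u \<in> bsyms n. \<forall>v \<in> bsyms n. \<forall>w \<in> bsyms n.
           (\<forall>((u', v', w'), c) \<in> set P. mset [u, v, w] \<noteq> mset [u', v', w']) \<longrightarrow>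
           form L (mul L (e u) (e v)) (e w) = 0"
    using assms(4) unfolding presented_by_def by blast
  have inj: "inj f" using bij by (rule bij_is_inj)
  have "standard_basis M n (f \<circ> e)"
    unfolding standard_basis_def
  proof (intro conjI)
    show "inj_on (f \<circ> e) (bsyms n)"
      using e inj by (auto simp: standard_basis_def intro: comp_inj_on inj_on_subset)
    show "m.independent ((f \<circ> e) ` bsyms n)"
      using e inj vp.linear_independent_injective_image[OF lin, of "e ` bsyms n"]
      by (auto simp: standard_basis_def image_comp)
    show "m.span ((f \<circ> e) ` bsyms n) = UNIV"
      using e bij vp.linear_span_image[OF lin, of "e ` bsyms n"]
      by (auto simp: standard_basis_def image_comp bij_def)
  qed (use e in \<open>auto simp: standard_basis_def form\<close>)
  then show ?thesis
    unfolding presented_by_def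
    by (intro exI[of _ "f \<circ> e"]) (use P in \<open>simp add: form flip: mul\<close>)
qed

text \<open>Identifying the coordinates is an isomorphism, since product and form are given by the
  same coordinate formulas in both algebras.\<close>

lemma presented_by_same_iso:
  assumes "saa L" "saa M" and r: "r \<noteq> 0"
    and "presented_by L 5 (P10_2_4 r)" "presented_by M 5 (P10_2_4 r)"
  shows "saa_isomorphic L M"
proof -
  interpret l: saa L by fact
  interpret m: saa M by fact
  obtain e where "presented_saa L r e"
    using l.presented_imp_presform[OF assms(4)] r \<open>saa L\<close>
    by (metis presented_saa_def presented_saa_axioms_def)
  then interpret pl: presented_saa L r e .
  obtain e' where "presented_saa M r e'"
    using m.presented_imp_presform[OF assms(5)] r \<open>saa M\<close>
    by (metis presented_saa_def presented_saa_axioms_def)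
  then interpret pm: presented_saa M r e' .
  define f where "f w = (\<Sum>b\<in>bsyms 5. scl M (l.crd e b w) (e' b))" for w
  define g where "g w = (\<Sum>b\<in>bsyms 5. scl L (m.crd e' b w) (e b))" for w
  have crd_f: "m.crd e' b (f w) = l.crd e b w" if "b \<in> bsyms 5" for b w
    using that by (simp add: f_def m.crd_sum if_distrib cong: if_cong sum.cong)
  have crd_g: "l.crd e b (g w) = m.crd e' b w" if "b \<in> bsyms 5" for b w
    using that by (simp add: g_def l.crd_sum if_distrib cong: if_cong sum.cong)
  have "Vector_Spaces.linear (scl L) (scl M) f"
    unfolding Vector_Spaces.linear_iff
    by (intro conjI allI l.vector_space_axioms m.vector_space_axioms; rule pm.vec_eqI; simp add: crd_f)
  moreover have "bij f"
  proof (rule bij_betw_byWitness[where f' = g])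
    show "\<forall>a\<in>UNIV. g (f a) = a"
      by (intro ballI pl.vec_eqI) (simp add: crd_f crd_g)
    show "\<forall>a\<in>UNIV. f (g a) = a"
      by (intro ballI pm.vec_eqI) (simp add: crd_f crd_g)
  qed auto
  moreover have "f (mul L x y) = mul M (f x) (f y)" for x y
    by (rule pm.vec_eqI) (simp add: crd_f bsyms_5 pm.minor_def pl.minor_def)
  moreover have "form M (f x) (f y) = form L x y" for x y
    by (simp add: pl.form_crd pm.form_crd crd_f)
  ultimately show ?thesis
    unfolding saa_isomorphic_def saa_iso_def by blast
qed

text \<open>On a symplectic space every alternating trilinear form defines a product, so the axioms
  reduce to properties of \<open>presform\<close> and of the standard form on F^10.\<close>

lemma ex_presented_saa:
  fixes r :: "'a::field"
  shows "\<exists>N :: ('a, 'a ^ 10) sympl_struct. saa N \<and> presented_by N 5 (P10_2_4 r)"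
proof -
  obtain ix :: "bsym \<Rightarrow> 10" where ix: "bij_betw ix (bsyms 5) UNIV"
    using finite_same_card_bij[of "bsyms 5" "UNIV :: 10 set"] by (auto simp: card_bsyms)
  \<comment> \<open>\<open>vc\<close> and \<open>co\<close> pass between functions on the symbols
    and vectors; \<open>ix\<close> labels the ten positions by symbols.\<close>
  define vc :: "(bsym \<Rightarrow> 'a) \<Rightarrow> 'a ^ 10" where "vc g = (\<chi> k. g (inv_into (bsyms 5) ix k))" for g
  define co :: "'a ^ 10 \<Rightarrow> bsym \<Rightarrow> 'a" where "co w b = w $ ix b" for w b
  define \<delta> :: "bsym \<Rightarrow> bsym \<Rightarrow> 'a" where "\<delta> s b = (if b = s then 1 else 0)" for s b
  have co_vc: "co (vc g) b = g b" if "b \<in> bsyms 5" for g b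
    using that bij_betw_inv_into_left[OF ix] by (simp add: co_def vc_def)
  have co_lin: "co (x + y) b = co x b + co y b" "co (c *s x) b = c * co x b" for x y c b
    by (simp_all add: co_def)
  have eqI: "x = y" if "\<And>b. b \<in> bsyms 5 \<Longrightarrow> co x b = co y b" for x y
  proof (unfold vec_eq_iff, rule allI)
    fix k
    show "x $ k = y $ k"
      using that[of "inv_into (bsyms 5) ix k"] bij_betw_inv_into_right[OF ix, of k]
        bij_betwE[OF bij_betw_inv_into[OF ix], rule_format, of k] by (simp add: co_def)
  qed
  define fo where "fo x y = (\<Sum>i\<in>{1, 2, 3, 4, 5}. co x (X i) * co y (Y i) - co x (Y i) * co y (X i))" for x y
  \<comment> \<open>The coordinates are the prescribed pairings of the product with basis vectors;
    the sign reflects (y_i, x_i) = -1.\<close>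
  define mu where "mu x y = vc (\<lambda>b. case b of X i \<Rightarrow> presform r (co x) (co y) (\<delta> (Y i))
      | Y i \<Rightarrow> - presform r (co x) (co y) (\<delta> (X i)))" for x y
  define N :: "('a, 'a ^ 10) sympl_struct" where "N = \<lparr>scl = (*s), mul = mu, form = fo\<rparr>"
  have sel [simp]: "scl N = (*s)" "mul N = mu" "form N = fo"
    by (simp_all add: N_def)
  have fo_mu: "fo (mu x y) z = presform r (co x) (co y) (co z)" for x y z
    by (simp add: fo_def mu_def co_vc presform_def det3_def \<delta>_def algebra_simps)
  have fo_vc: "fo x (vc (\<delta> (Y i))) = co x (X i)" "fo x (vc (\<delta> (X i))) = - co x (Y i)" if "i \<in> {1..5}" for x i
  proof -
    have "i = 1 \<or> i = 2 \<or> i = 3 \<or> i = 4 \<or> i = 5" using that by auto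
    then show "fo x (vc (\<delta> (Y i))) = co x (X i)" "fo x (vc (\<delta> (X i))) = - co x (Y i)"
      by (auto simp: fo_def co_vc \<delta>_def)
  qed
  have vs: "vector_space ((*s) :: 'a \<Rightarrow> 'a ^ 10 \<Rightarrow> 'a ^ 10)" ..
  have vs': "vector_space ((*) :: 'a \<Rightarrow> 'a \<Rightarrow> 'a)"
    by unfold_locales (simp_all add: algebra_simps)
  have "saa N"
  proof (unfold saa_def saa_axioms_def sel, intro conjI allI impI vs)
    show "\<exists>B. finite B \<and> vec.span B = (UNIV :: ('a ^ 10) set)"
      using vec.finite_Basis vec.span_Basis by blast
    fix x y z
    show "Vector_Spaces.linear (*s) (*) (\<lambda>x. fo x y)" "Vector_Spaces.linear (*s) (*) (fo x)"
      unfolding Vector_Spaces.linear_iff using vs vs' by (simp_all add: fo_def co_lin algebra_simps)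
    show "fo x x = 0" by (simp add: fo_def)
    show "Vector_Spaces.linear (*s) (*s) (\<lambda>x. mu x y)" "Vector_Spaces.linear (*s) (*s) (mu x)"
      unfolding Vector_Spaces.linear_iff using vs
      by (auto intro!: eqI simp: mu_def co_vc co_lin presform_def det3_def algebra_simps split: bsym.split)
    have "presform r f f g = 0" for f g
      by (simp add: presform_def det3_def algebra_simps)
    then show "mu x x = 0"
      by (intro eqI) (auto simp: mu_def co_vc co_def[of 0] split: bsym.split)
    show "fo (mu x y) z = fo (mu y z) x"
      by (simp add: fo_mu presform_def det3_def algebra_simps)
  next
    fix x assume 0: "\<forall>y. fo x y = 0"
    show "x = 0"
    proof (rule eqI)
      fix b assume "b \<in> bsyms 5"
      then show "co x b = co 0 b"
        using 0 fo_vc[of _ x] by (cases b) (auto simp: co_def[of 0])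
    qed
  qed
  then interpret N: saa N .
  define e where "e = (\<lambda>b. vc (\<delta> b))"
  have e: "N.gram 5 e"
    by (auto simp: N.gram_def e_def fo_vc co_vc \<delta>_def)
  have std: "standard_basis N 5 e"
    using vec_dim_card[where 'a = 'a and 'n = 10] by (intro N.standard_basisI e) (simp del: vec.dim_UNIV N.dim_UNIV)
  have crd: "N.crd e b x = co x b" if "b \<in> bsyms 5" for b x
    using that fo_vc(1)[of _ x] fo_vc(2)[of _ x] N.form_anticomm[of _ x]
    by (cases b) (auto simp: N.crd_def e_def)
  have "N.tri x y z = presform r (\<lambda>b. N.crd e b x) (\<lambda>b. N.crd e b y) (\<lambda>b. N.crd e b z)" for x y z
    by (simp add: N.tri_def fo_mu presform_def det3_def crd)
  then have "presented_by N 5 (P10_2_4 r)"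
    by (rule N.presented_by_presformI[OF std])
  then show ?thesis
    using \<open>saa N\<close> by blast
qed

text \<open>The last conjunct realises every parameter, so the claims about presented algebras are
  not vacuous. The two algebras may live on different types.\<close>

theorem proposition3p4:
  fixes L :: "('a::field, 'v::ab_group_add) sympl_struct"
    and M :: "('a, 'w::ab_group_add) sympl_struct"
  assumes "saa L" and "saa M"
  shows "(has_stated_properties L \<longrightarrow> (\<exists>r. r \<noteq> 0 \<and> presented_by L 5 (P10_2_4 r))) \<and>
    (\<forall>r s. r \<noteq> 0 \<longrightarrow> s \<noteq> 0 \<longrightarrow>
       presented_by L 5 (P10_2_4 r) \<longrightarrow> presented_by M 5 (P10_2_4 s) \<longrightarrow>
       (saa_isomorphic L M \<longleftrightarrow> s / r \<in> unit_powers 11)) \<and>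
    (\<forall>r. r \<noteq> 0 \<longrightarrow> presented_by L 5 (P10_2_4 r) \<longrightarrow> has_stated_properties L) \<and>
    (\<forall>r::'a. r \<noteq> 0 \<longrightarrow>
       (\<exists>N :: ('a, 'a ^ 10) sympl_struct. saa N \<and> presented_by N 5 (P10_2_4 r)))"
proof (intro conjI allI impI ex_presented_saa)
  interpret l: saa L by fact
  interpret m: saa M by fact
  show "\<exists>r. r \<noteq> 0 \<and> presented_by L 5 (P10_2_4 r)" if "has_stated_properties L"
  proof -
    interpret stated_saa L by unfold_locales fact
    obtain r u v where "l.normal_pair r u v" using ex_normal_pair by blast
    then show ?thesis
      using normal_pair_presented by (auto simp: l.normal_pair_def)
  qed
  fix r :: 'a assume r: "r \<noteq> 0" and L: "presented_by L 5 (P10_2_4 r)"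
  obtain e where "presented_saa L r e"
    using l.presented_imp_presform[OF L] r \<open>saa L\<close>
    by (metis presented_saa_def presented_saa_axioms_def)
  then interpret pl: presented_saa L r e .
  show stated: "has_stated_properties L" by (rule pl.has_stated_properties)
  interpret stated_saa L by unfold_locales (rule stated)
  fix s :: 'a assume s: "s \<noteq> 0" and M: "presented_by M 5 (P10_2_4 s)"
  show "saa_isomorphic L M \<longleftrightarrow> s / r \<in> unit_powers 11"
  proof
    assume "saa_isomorphic L M"
    then obtain f where f: "saa_iso L M f" by (auto simp: saa_isomorphic_def)
    obtain e' where "presented_saa M s e'"
      using m.presented_imp_presform[OF M] s \<open>saa M\<close>
      by (metis presented_saa_def presented_saa_axioms_def)
    then interpret pm: presented_saa M s e' .
    \<comment> \<open>Transporting along \<open>f\<close> gives \<open>M\<close> both presentations,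
      so r and s are compared within one algebra.\<close>
    have "presented_by M 5 (P10_2_4 r)"
      by (rule presented_by_iso[OF assms f L])
    then obtain e'' where "presented_saa M r e''"
      using m.presented_imp_presform r \<open>saa M\<close>
      by (metis presented_saa_def presented_saa_axioms_def)
    then interpret pm': presented_saa M r e'' .
    show "s / r \<in> unit_powers 11"
      by (rule pm'.normal_pair_unique[OF pm.normal_pair_basis])
  next
    assume "s / r \<in> unit_powers 11"
    then obtain c where c: "c \<noteq> 0" "s = r * c ^ 11"
      using r by (auto simp: unit_powers_def field_simps)
    \<comment> \<open>The pair (c^4 y_4, c^2 y_5) gives \<open>L\<close> a second presentation, with
      the parameter of \<open>M\<close>.\<close>
    have "presented_by L 5 (P10_2_4 s)"
      unfolding c(2) by (rule normal_pair_presented[OF l.normal_pair_scale[OF pl.normal_pair_basis c(1)]])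
    then show "saa_isomorphic L M"
      using presented_by_same_iso[OF assms s _ M] by blast
  qed
qed

end
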